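(* Let $(\alpha,\beta,t)$ be an admissible triple with $\alpha>0$ (see context), let $P=\widetilde P_L\widetilde P_U$ be the stochastic LU factorization of the associated stochastic tridiagonal matrix $P$ given in the context, let $\widehat P=\widetilde P_U\widetilde P_L$, and let $\boldsymbol\Psi$ be the spectral matrix of $P$. Then: (i) $\widehat P$ is a stochastic tridiagonal matrix whose coefficients $\hat p_n=\widehat P_{n,n+1}$, $\hat r_n=\widehat P_{n,n}$, $\hat q_n=\widehat P_{n,n-1}$ ($n\in\mathbb{Z}$) are $p_{n+1},r_{n+1},q_{n+1}$, respectively, with $\alpha$ replaced by $\alpha-1$. (ii) The spectral matrix $\widehat{\boldsymbol\Psi}$ of $\widehat P$ is absolutely continuous on $[0,1]$ (no discrete part) and is given by $$\widehat{\boldsymbol\Psi}(x)=\frac{x_0}{t_1}\,\boldsymbol T_0(x)\,\frac{\boldsymbol\Psi(x)}{x}\,\boldsymbol T_0^*(x),\qquad \boldsymbol T_0(x)=\begin{pmatrix} \dfrac{x-s_0y_0}{x_0}& -\dfrac{y_0t_0}{x_0} \\ s_0& t_0\end{pmatrix}.$$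
   Context: Admissible triples with $\alpha>0$: $0<\alpha<1$, $-1<\beta<0$, $t\in\mathbb{R}$, and one of the following holds: (A1) $\beta-\alpha+1>0$, $\alpha>-\beta$, and $t\in\bigcup_{n\in\mathbb{Z}}(n,n-\beta)\cup(n-\alpha,n-\alpha-\beta)$; (A2) $\beta-\alpha+1>0$, $\alpha<-\beta$, and $t\in\bigcup_{n\in\mathbb{Z}}(n-\alpha,n)\cup(n-\alpha-\beta,n-\beta)$; (B1) $\beta-\alpha+1<0$, $\alpha>-\beta$, and $t\in\bigcup_{n\in\mathbb{Z}}(n,n-\alpha+1)\cup(n-\beta,n-\alpha-\beta+1)$; (B2) $\beta-\alpha+1<0$, $\alpha<-\beta$, and $t\in\bigcup_{n\in\mathbb{Z}}(n-\beta-1,n)\cup(n-\alpha-\beta,n-\alpha+1)$. Coefficients: for $n\in\mathbb{Z}$, $$p_n=\frac{(n+t+\beta+1)(n+t+\alpha+\beta+1)}{(2n+2t+\alpha+\beta+1)(2n+2t+\alpha+\beta+2)},\qquad q_n=\frac{(n+t)(n+t+\alpha)}{(2n+2t+\alpha+\beta)(2n+2t+\alpha+\beta+1)},$$ $$r_n=\frac{(n+t+\beta+1)(n+t+1)}{(2n+2t+\alpha+\beta+1)(2n+2t+\alpha+\beta+2)}+\frac{(n+t+\alpha)(n+t+\alpha+\beta)}{(2n+2t+\alpha+\beta)(2n+2t+\alpha+\beta+1)}.$$ $P$ is the doubly infinite tridiagonal matrix (indexed by $\mathbb{Z}$) with $P_{n,n+1}=p_n$, $P_{n,n}=r_n$,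 $P_{n,n-1}=q_n$, other entries $0$. It is stochastic with $p_n,r_n,q_n>0$ for admissible triples. Factorization: put $$y_n=\frac{n+t+\alpha}{2n+2t+\alpha+\beta+1},\quad x_n=\frac{n+t+\beta+1}{2n+2t+\alpha+\beta+1},\quad s_n=\frac{n+t+\alpha+\beta}{2n+2t+\alpha+\beta},\quad t_n=\frac{n+t}{2n+2t+\alpha+\beta}.$$ Let $\widetilde P_L$ be the doubly infinite lower bidiagonal matrix with $(\widetilde P_L)_{n,n}=x_n$, $(\widetilde P_L)_{n,n-1}=y_n$, and $\widetilde P_U$ the doubly infinite upper bidiagonal matrix with $(\widetilde P_U)_{n,n}=t_{n+1}$, $(\widetilde P_U)_{n,n+1}=s_{n+1}$. Then $P=\widetilde P_L\widetilde P_U$ and both factors are stochastic. (The sequence $(t_n)$ is not to be confused with the parameter $t$.) Spectral matrix: for a doubly infinite stochastic tridiagonal matrix with coefficients $p_n,q_n>0$, $r_n$, let $Q^\eta_n$, $\eta=1,2$, $n\in\mathbb{Z}$, be the polynomials with $Q^1_0=1,Q^1_{-1}=0$, $Q^2_0=0,Q^2_{-1}=1$ and $xQ^\eta_n=p_nQ^\eta_{n+1}+r_nQ^\eta_n+q_nQ^\eta_{n-1}$ for all $n\in\mathbb{Z}$. Let $\pi_0=1$, $\pi_n=\frac{p_0\cdots p_{n-1}}{q_1\cdots q_n}$, $\pi_{-n}=\frac{q_0q_{-1}\cdots q_{-n+1}}{p_{-1}\cdots p_{-n}}$ for $n\ge1$. The spectral matrix is the $2\times2$ matrix of measures $\boldsymbol\Psi$,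 positive semidefinite and supported on $[-1,1]$, such that $$\int (Q^1_i(x),Q^2_i(x))\,d\boldsymbol\Psi(x)\,(Q^1_j(x),Q^2_j(x))^T=\frac{\delta_{ij}}{\pi_j},\qquad i,j\in\mathbb{Z}.$$ When it is absolutely continuous its density is denoted $\boldsymbol\Psi(x)$. It is a known result (Grünbaum–Haine) that, for $-1<\alpha,\beta<1$ and $t$ real such that $p_{n-1}q_n>0$ for all $n\in\mathbb{Z}$, the spectral matrix of the matrix with the coefficients $p_n,r_n,q_n$ displayed above is absolutely continuous and supported on $[0,1]$. $M^*$ denotes the Hermitian transpose of $M$. *)

theory Defs
  imports "HOL-Analysis.Analysis" "HOL-Computational_Algebra.Polynomial"
begin

section \<open>Doubly infinite matrices\<close>

definition bi_mult :: "(int \<Rightarrow> int \<Rightarrow> real) \<Rightarrow> (int \<Rightarrow> int \<Rightarrow> real) \<Rightarrow> int \<Rightarrow> int \<Rightarrow> real" where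
  "bi_mult A B = (\<lambda>i j. \<Sum>\<^sub>\<infinity>k\<in>UNIV. A i k * B k j)"

definition stochastic :: "(int \<Rightarrow> int \<Rightarrow> real) \<Rightarrow> bool" where
  "stochastic A \<longleftrightarrow> (\<forall>i j. 0 \<le> A i j) \<and> (\<forall>i. (A i has_sum 1) UNIV)"

definition tridiagonal :: "(int \<Rightarrow> int \<Rightarrow> real) \<Rightarrow> bool" where
  "tridiagonal A \<longleftrightarrow> (\<forall>i j. \<bar>i - j\<bar> > 1 \<longrightarrow> A i j = 0)"

section \<open>Matrices of measures\<close>

text \<open>A positive semidefinite \<open>2 \<times> 2\<close> matrix of measures is a countably additive function from the
  Borel sets of the real line to the real positive semidefinite matrices. Its off-diagonal entries
  are finite signed measures. Values on sets that are not Borel are irrelevant.\<close>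

definition psd :: "real^'n^'n \<Rightarrow> bool" where
  "psd A \<longleftrightarrow> transpose A = A \<and> (\<forall>v. 0 \<le> v \<bullet> (A *v v))"

definition matrix_measure :: "(real set \<Rightarrow> real^2^2) \<Rightarrow> bool" where
  "matrix_measure M \<longleftrightarrow>
     (\<forall>A\<in>sets borel. psd (M A)) \<and>
     (\<forall>F :: nat \<Rightarrow> real set. range F \<subseteq> sets borel \<longrightarrow> disjoint_family F \<longrightarrow>
        (\<lambda>k. M (F k)) sums M (\<Union>k. F k))"

definition quad_measure :: "(real set \<Rightarrow> real^2^2) \<Rightarrow> real^2 \<Rightarrow> real measure" where
  "quad_measure M v = measure_of UNIV (sets borel) (\<lambda>A. ennreal (v \<bullet> (M A *v v)))"

text \<open>The integral against the (possibly signed) entry \<open>M\<^sub>i\<^sub>j\<close>, obtained by polarization: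
  \<open>4 M\<^sub>i\<^sub>j\<close> is the difference of the positive measures given by the quadratic form of \<open>M\<close>
  at \<open>e\<^sub>i + e\<^sub>j\<close> and at \<open>e\<^sub>i - e\<^sub>j\<close>.\<close>

definition entry_integral :: "(real set \<Rightarrow> real^2^2) \<Rightarrow> 2 \<Rightarrow> 2 \<Rightarrow> (real \<Rightarrow> real) \<Rightarrow> real" where
  "entry_integral M i j f =
     ((LINT x|quad_measure M (axis i 1 + axis j 1). f x) -
      (LINT x|quad_measure M (axis i 1 - axis j 1). f x)) / 4"

text \<open>\<open>M\<close> is absolutely continuous and concentrated on \<open>S\<close>, with density \<open>W\<close> there.\<close>

definition has_density_on :: "(real set \<Rightarrow> real^2^2) \<Rightarrow> real set \<Rightarrow> (real \<Rightarrow> real^2^2) \<Rightarrow> bool" where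
  "has_density_on M S W \<longleftrightarrow>
     set_integrable lborel S W \<and>
     (\<forall>A\<in>sets borel. M A = (LINT x:A \<inter> S|lborel. W x))"

section \<open>Spectral matrices of tridiagonal matrices\<close>

text \<open>\<open>Q \<eta> n\<close> is the polynomial \<open>Q\<^sup>\<eta>\<^sub>n\<close>. If all \<open>A n (n + 1)\<close> and \<open>A n (n - 1)\<close> are
  nonzero, there is exactly one such family.\<close>

definition spectral_polys :: "(int \<Rightarrow> int \<Rightarrow> real) \<Rightarrow> (2 \<Rightarrow> int \<Rightarrow> real poly) \<Rightarrow> bool" where
  "spectral_polys A Q \<longleftrightarrow>
     Q 1 0 = 1 \<and> Q 1 (-1) = 0 \<and> Q 2 0 = 0 \<and> Q 2 (-1) = 1 \<and>
     (\<forall>\<eta> n. [:0, 1:] * Q \<eta> n =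
        smult (A n (n + 1)) (Q \<eta> (n + 1)) + smult (A n n) (Q \<eta> n)
        + smult (A n (n - 1)) (Q \<eta> (n - 1)))"

definition potential :: "(int \<Rightarrow> int \<Rightarrow> real) \<Rightarrow> int \<Rightarrow> real" where
  "potential A n =
     (if 0 \<le> n then (\<Prod>k\<in>{0..n - 1}. A k (k + 1)) / (\<Prod>k\<in>{1..n}. A k (k - 1))
      else (\<Prod>k\<in>{n + 1..0}. A k (k - 1)) / (\<Prod>k\<in>{n..-1}. A k (k + 1)))"

definition spectral_matrix :: "(int \<Rightarrow> int \<Rightarrow> real) \<Rightarrow> (real set \<Rightarrow> real^2^2) \<Rightarrow> bool" where
  "spectral_matrix A M \<longleftrightarrow>
     matrix_measure M \<and> M (- {-1..1}) = 0 \<and>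
     (\<exists>Q. spectral_polys A Q \<and>
       (\<forall>i j. (\<Sum>\<eta>\<in>UNIV. \<Sum>\<xi>\<in>UNIV.
                  entry_integral M \<eta> \<xi> (\<lambda>x. poly (Q \<eta> i) x * poly (Q \<xi> j) x))
              = (if i = j then 1 / potential A j else 0)))"

section \<open>The coefficients\<close>

definition admissible :: "real \<Rightarrow> real \<Rightarrow> real \<Rightarrow> bool" where
  "admissible \<alpha> \<beta> t \<longleftrightarrow>
     0 < \<alpha> \<and> \<alpha> < 1 \<and> -1 < \<beta> \<and> \<beta> < 0 \<and>
     (\<beta> - \<alpha> + 1 > 0 \<and> \<alpha> > -\<beta> \<and>
        t \<in> (\<Union>n::int. {n<..<n - \<beta>} \<union> {n - \<alpha><..<n - \<alpha> - \<beta>}) \<or>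
      \<beta> - \<alpha> + 1 > 0 \<and> \<alpha> < -\<beta> \<and>
        t \<in> (\<Union>n::int. {n - \<alpha><..<n} \<union> {n - \<alpha> - \<beta><..<n - \<beta>}) \<or>
      \<beta> - \<alpha> + 1 < 0 \<and> \<alpha> > -\<beta> \<and>
        t \<in> (\<Union>n::int. {n<..<n - \<alpha> + 1} \<union> {n - \<beta><..<n - \<alpha> - \<beta> + 1}) \<or>
      \<beta> - \<alpha> + 1 < 0 \<and> \<alpha> < -\<beta> \<and>
        t \<in> (\<Union>n::int. {n - \<beta> - 1<..<n} \<union> {n - \<alpha> - \<beta><..<n - \<alpha> + 1}))"

definition p_coeff :: "real \<Rightarrow> real \<Rightarrow> real \<Rightarrow> int \<Rightarrow> real" where
  "p_coeff \<alpha> \<beta> t n = (n + t + \<beta> + 1) * (n + t + \<alpha> + \<beta> + 1)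
     / ((2*n + 2*t + \<alpha> + \<beta> + 1) * (2*n + 2*t + \<alpha> + \<beta> + 2))"

definition q_coeff :: "real \<Rightarrow> real \<Rightarrow> real \<Rightarrow> int \<Rightarrow> real" where
  "q_coeff \<alpha> \<beta> t n = (n + t) * (n + t + \<alpha>)
     / ((2*n + 2*t + \<alpha> + \<beta>) * (2*n + 2*t + \<alpha> + \<beta> + 1))"

definition r_coeff :: "real \<Rightarrow> real \<Rightarrow> real \<Rightarrow> int \<Rightarrow> real" where
  "r_coeff \<alpha> \<beta> t n =
     (n + t + \<beta> + 1) * (n + t + 1)
       / ((2*n + 2*t + \<alpha> + \<beta> + 1) * (2*n + 2*t + \<alpha> + \<beta> + 2))
     + (n + t + \<alpha>) * (n + t + \<alpha> + \<beta>)
       / ((2*n + 2*t + \<alpha> + \<beta>) * (2*n + 2*t + \<alpha> + \<beta> + 1))"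

definition P_mat :: "real \<Rightarrow> real \<Rightarrow> real \<Rightarrow> int \<Rightarrow> int \<Rightarrow> real" where
  "P_mat \<alpha> \<beta> t i j =
     (if j = i + 1 then p_coeff \<alpha> \<beta> t i
      else if j = i then r_coeff \<alpha> \<beta> t i
      else if j = i - 1 then q_coeff \<alpha> \<beta> t i
      else 0)"

section \<open>The LU factorization\<close>

definition y_seq :: "real \<Rightarrow> real \<Rightarrow> real \<Rightarrow> int \<Rightarrow> real" where
  "y_seq \<alpha> \<beta> t n = (n + t + \<alpha>) / (2*n + 2*t + \<alpha> + \<beta> + 1)"

definition x_seq :: "real \<Rightarrow> real \<Rightarrow> real \<Rightarrow> int \<Rightarrow> real" where
  "x_seq \<alpha> \<beta> t n = (n + t + \<beta> + 1) / (2*n + 2*t + \<alpha> + \<beta> + 1)"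

definition s_seq :: "real \<Rightarrow> real \<Rightarrow> real \<Rightarrow> int \<Rightarrow> real" where
  "s_seq \<alpha> \<beta> t n = (n + t + \<alpha> + \<beta>) / (2*n + 2*t + \<alpha> + \<beta>)"

definition t_seq :: "real \<Rightarrow> real \<Rightarrow> real \<Rightarrow> int \<Rightarrow> real" where
  "t_seq \<alpha> \<beta> t n = (n + t) / (2*n + 2*t + \<alpha> + \<beta>)"

definition PL_mat :: "real \<Rightarrow> real \<Rightarrow> real \<Rightarrow> int \<Rightarrow> int \<Rightarrow> real" where
  "PL_mat \<alpha> \<beta> t i j =
     (if j = i then x_seq \<alpha> \<beta> t i
      else if j = i - 1 then y_seq \<alpha> \<beta> t i
      else 0)"

definition PU_mat :: "real \<Rightarrow> real \<Rightarrow> real \<Rightarrow> int \<Rightarrow> int \<Rightarrow> real" where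
  "PU_mat \<alpha> \<beta> t i j =
     (if j = i then t_seq \<alpha> \<beta> t (i + 1)
      else if j = i + 1 then s_seq \<alpha> \<beta> t (i + 1)
      else 0)"

definition Phat_mat :: "real \<Rightarrow> real \<Rightarrow> real \<Rightarrow> int \<Rightarrow> int \<Rightarrow> real" where
  "Phat_mat \<alpha> \<beta> t = bi_mult (PU_mat \<alpha> \<beta> t) (PL_mat \<alpha> \<beta> t)"

definition T0_mat :: "real \<Rightarrow> real \<Rightarrow> real \<Rightarrow> real \<Rightarrow> real^2^2" where
  "T0_mat \<alpha> \<beta> t x =
     (let x0 = x_seq \<alpha> \<beta> t 0; y0 = y_seq \<alpha> \<beta> t 0; s0 = s_seq \<alpha> \<beta> t 0; t0 = t_seq \<alpha> \<beta> t 0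
      in vector [vector [(x - s0 * y0) / x0, - (y0 * t0) / x0],
                 vector [s0, t0]])"

end

theory Submission
  imports Defs
begin

text \<open>
Write \<open>P = L U\<close> and \<open>Phat = U L\<close>. If \<open>q\<^sub>n\<close> is the row vector \<open>(Q\<^sup>1\<^sub>n, Q\<^sup>2\<^sub>n)\<close>, then
\<open>qh = U q\<close> satisfies \<open>z q = L qh\<close> and hence the recurrence of \<open>Phat\<close>; its values at the indices
\<open>0\<close> and \<open>-1\<close> are the two rows of \<open>T\<^sub>0\<close>. So the polynomials of \<open>Phat\<close>, multiplied by \<open>T\<^sub>0\<close>,
are the \<open>qh\<^sub>n\<close>, and everything reduces to showing that, up to the constant \<open>c = x\<^sub>0 / t\<^sub>1\<close>, the
\<open>qh\<^sub>n\<close> are orthogonal with respect to \<open>\<Psi>(z) dz / z\<close>.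

In operator terms \<open>L\<close> is, up to a constant, the adjoint of \<open>U\<close> between the weighted \<open>\<ell>\<^sup>2\<close> spaces of \<open>P\<close> and
\<open>Phat\<close>, so \<open>P = U* U\<close> and \<open>Phat = U U*\<close>. For a vector \<open>v = U* u\<close> the integral of \<open>1/z\<close> against the
spectral measure of \<open>v\<close> is finite and equals the squared norm of the projection of \<open>u\<close> onto
the orthogonal complement of the kernel of \<open>U*\<close>. Two things therefore have to be proved.

The singularity \<open>1/z\<close> is integrable. The partial sums \<open>p\<^sub>n(z) = \<Sum>k<n. (1 - z)\<^sup>k\<close> increase to \<open>1/z\<close> on \<open>(0, 1]\<close>,
and the Gram matrix of the \<open>qh\<^sub>i\<close> against \<open>p\<^sub>n(z) \<Psi>(z) dz\<close> differs from the expected diagonal matrix by the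
matrix of \<open>(I - Phat)\<^sup>n\<close>, up to weights. For even \<open>n\<close> this is a square of a symmetric matrix, so its
diagonal is nonnegative (lemma \<open>E_even_nonneg\<close>), and monotone convergence applies (\<open>qh_diag_over\<close>).

There is no mass at \<open>0\<close>. The defect \<open>D\<close> between the diagonal matrix and the Gram matrix for \<open>\<Psi>(z) dz / z\<close> is
annihilated by \<open>L\<close>, hence of the form \<open>\<kappa> f\<^sub>i f\<^sub>j\<close> with \<open>f\<close> the solution of \<open>L f = 0\<close>. It is positive
semidefinite and bounded by the diagonal matrix, so \<open>\<kappa> \<noteq> 0\<close> would force \<open>f\<close> to be square summable
(\<open>D_eq_0\<close>). But its weighted square terms behave like \<open>n\<^bsup>2\<alpha>-1\<^esup>\<close>, and \<open>\<alpha> > 0\<close> makes the sum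
diverge (\<open>kernel_diverges\<close>).

Finally, the spectral matrix is unique: orthogonality determines all moments, and a matrix measure
on \<open>[-1, 1]\<close> is determined by its moments (\<open>matrix_measure_determinate\<close>). So the matrix with the
claimed density is the spectral matrix of \<open>Phat\<close>.
\<close>

section \<open>Three-term recurrences over the integers\<close>

lemma int_step_induct [case_names zero neg step down]:
  fixes P :: "int \<Rightarrow> bool"
  assumes "P 0" and "P (-1)" and "\<And>n. P (n - 1) \<Longrightarrow> P n \<Longrightarrow> P (n + 1)"
    and "\<And>n. P n \<Longrightarrow> P (n + 1) \<Longrightarrow> P (n - 1)"
  shows "P n"
proof -
  have up: "P (int k - 1) \<and> P (int k)" for k
  proof (induction k)
    case (Suc k)
    then have "P (int k + 1)" using assms(3) by blast
    with Suc show ?case by (simp add: add.commute)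
  qed (use assms in simp)
  have down: "P (- int k) \<and> P (- int k - 1)" for k
  proof (induction k)
    case (Suc k)
    then have "P ((- int k - 1) - 1)" using assms(4)[of "- int k - 1"] by simp
    moreover have "- int (Suc k) = - int k - 1" "- int (Suc k) - 1 = (- int k - 1) - 1" by simp_all
    ultimately show ?case using Suc by metis
  qed (use assms in simp)
  show ?thesis
  proof (cases "0 \<le> n")
    case True
    then show ?thesis using up[of "nat n"] by simp
  next
    case False
    then show ?thesis using down[of "nat (- n)"] by simp
  qed
qed

lemma three_term_unique:
  fixes u v :: "int \<Rightarrow> real"
  assumes nz: "\<And>n. A n (n + 1) \<noteq> 0" "\<And>n. A n (n - 1) \<noteq> 0"
    and u: "\<And>n. x * u n = A n (n + 1) * u (n + 1) + A n n * u n + A n (n - 1) * u (n - 1)"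
    and v: "\<And>n. x * v n = A n (n + 1) * v (n + 1) + A n n * v n + A n (n - 1) * v (n - 1)"
    and init: "u 0 = v 0" "u (-1) = v (-1)"
  shows "u n = v n"
proof (induction n rule: int_step_induct)
  case (step n)
  then have "x * v n = A n (n + 1) * u (n + 1) + A n n * v n + A n (n - 1) * v (n - 1)"
    using u[of n] by simp
  then have "A n (n + 1) * u (n + 1) = A n (n + 1) * v (n + 1)"
    using v[of n] by linarith
  then show ?case using nz by simp
next
  case (down n)
  then have "x * v n = A n (n + 1) * v (n + 1) + A n n * v n + A n (n - 1) * u (n - 1)"
    using u[of n] by simp
  then have "A n (n - 1) * u (n - 1) = A n (n - 1) * v (n - 1)"
    using v[of n] by linarith
  then show ?case using nz by simp
qed (use init in simp_all)

lemma three_term_exists: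
  fixes A :: "int \<Rightarrow> int \<Rightarrow> real" and a b :: "real poly"
  assumes nz: "\<And>n. A n (n + 1) \<noteq> 0" "\<And>n. A n (n - 1) \<noteq> 0"
  shows "\<exists>R. R 0 = a \<and> R (-1) = b \<and> (\<forall>n. [:0, 1:] * R n =
        smult (A n (n + 1)) (R (n + 1)) + smult (A n n) (R n) + smult (A n (n - 1)) (R (n - 1)))"
proof -
  \<comment> \<open>Solve the recurrence upwards from the index 0 and downwards from the index -1; both runs carry two consecutive values.\<close>
  define F where "F = rec_nat (b, a) (\<lambda>k (u, v). (v, smult (1 / A (int k) (int k + 1))
     ([:0, 1:] * v - smult (A (int k) (int k)) v - smult (A (int k) (int k - 1)) u)))"
  define G where "G = rec_nat (a, b) (\<lambda>k (u, v). (v, smult (1 / A (- int k - 1) (- int k - 2))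
     ([:0, 1:] * v - smult (A (- int k - 1) (- int k - 1)) v - smult (A (- int k - 1) (- int k)) u)))"
  define R where "R n = (if 0 \<le> n then snd (F (nat n)) else snd (G (nat (- n - 1))))" for n :: int
  have F0: "F 0 = (b, a)" and G0: "G 0 = (a, b)" by (simp_all add: F_def G_def)
  have FS: "F (Suc k) = (snd (F k), smult (1 / A (int k) (int k + 1))
     ([:0, 1:] * snd (F k) - smult (A (int k) (int k)) (snd (F k)) - smult (A (int k) (int k - 1)) (fst (F k))))" for k
    by (simp add: F_def case_prod_beta)
  have GS: "G (Suc k) = (snd (G k), smult (1 / A (- int k - 1) (- int k - 2))
     ([:0, 1:] * snd (G k) - smult (A (- int k - 1) (- int k - 1)) (snd (G k)) - smult (A (- int k - 1) (- int k)) (fst (G k))))" for k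
    by (simp add: G_def case_prod_beta)
  have R_pos: "R (int k) = snd (F k)" and R_neg: "R (- int k - 1) = snd (G k)" for k
    by (simp_all add: R_def)
  have "fst (F k) = R (int k - 1)" for k
  proof (cases k)
    case (Suc j)
    then show ?thesis using R_pos[of j] by (simp add: FS)
  qed (use R_neg[of 0] in \<open>simp add: F0 G0\<close>)
  then have RF: "F k = (R (int k - 1), R (int k))" for k
    by (simp add: R_pos prod_eq_iff)
  have "fst (G k) = R (- int k)" for k
  proof (cases k)
    case (Suc j)
    then show ?thesis using R_neg[of j] by (simp add: GS minus_diff_commute)
  qed (use R_pos[of 0] in \<open>simp add: F0 G0\<close>)
  then have RG: "G k = (R (- int k), R (- int k - 1))" for k
    by (simp add: R_neg prod_eq_iff)
  have "[:0, 1:] * R n =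
        smult (A n (n + 1)) (R (n + 1)) + smult (A n n) (R n) + smult (A n (n - 1)) (R (n - 1))" for n
  proof (cases "0 \<le> n")
    case True
    then obtain k where k: "n = int k" by (metis nonneg_int_cases)
    have "R (n + 1) = snd (F (Suc k))" using R_pos[of "Suc k"] by (simp add: k add.commute)
    also have "\<dots> = smult (1 / A n (n + 1))
       ([:0, 1:] * R n - smult (A n n) (R n) - smult (A n (n - 1)) (R (n - 1)))"
      unfolding FS by (simp add: RF k)
    finally have "R (n + 1) = \<dots>" .
    then show ?thesis using nz by simp
  next
    case False
    define k where "k = nat (- n - 1)"
    have k: "n = - int k - 1" using False by (simp add: k_def)
    have "R (n - 1) = snd (G (Suc k))" using RG[of "Suc k"] by (simp add: k algebra_simps)
    also have "\<dots> = smult (1 / A n (n - 1))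
       ([:0, 1:] * R n - smult (A n n) (R n) - smult (A n (n + 1)) (R (n + 1)))"
    proof -
      have "- int k - 1 = n" "- int k - 2 = n - 1" "- int k = n + 1" using k by simp_all
      then show ?thesis unfolding GS by (simp only: RG fst_conv snd_conv)
    qed
    finally have "R (n - 1) = \<dots>" .
    then show ?thesis using nz(2)[of n] by simp
  qed
  moreover have "R 0 = a" "R (-1) = b" using RF[of 0] RG[of 0] F0 G0 by simp_all
  ultimately show ?thesis by blast
qed

lemma spectral_polys_exist:
  fixes A :: "int \<Rightarrow> int \<Rightarrow> real"
  assumes "\<And>n. A n (n + 1) \<noteq> 0" "\<And>n. A n (n - 1) \<noteq> 0"
  shows "\<exists>Q. spectral_polys A Q"
proof -
  obtain R where R: "R 0 = 1" "R (-1) = 0" "\<forall>n. [:0, 1:] * R n =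
        smult (A n (n + 1)) (R (n + 1)) + smult (A n n) (R n) + smult (A n (n - 1)) (R (n - 1))"
    using three_term_exists[OF assms] by metis
  obtain S where S: "S 0 = 0" "S (-1) = 1" "\<forall>n. [:0, 1:] * S n =
        smult (A n (n + 1)) (S (n + 1)) + smult (A n n) (S n) + smult (A n (n - 1)) (S (n - 1))"
    using three_term_exists[OF assms] by metis
  have "spectral_polys A (\<lambda>\<eta>. if \<eta> = 1 then R else S)"
    using R S by (simp add: spectral_polys_def)
  then show ?thesis by blast
qed

lemma spectral_polys_poly:
  assumes "spectral_polys A Q"
  shows "x * poly (Q \<eta> n) x = A n (n + 1) * poly (Q \<eta> (n + 1)) x + A n n * poly (Q \<eta> n) x
            + A n (n - 1) * poly (Q \<eta> (n - 1)) x"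
proof -
  have "poly ([:0, 1:] * Q \<eta> n) x = poly (smult (A n (n + 1)) (Q \<eta> (n + 1)) + smult (A n n) (Q \<eta> n)
        + smult (A n (n - 1)) (Q \<eta> (n - 1))) x"
    using assms by (simp add: spectral_polys_def)
  then show ?thesis by simp
qed

lemma spectral_polys_unique:
  assumes nz: "\<And>n. A n (n + 1) \<noteq> 0" "\<And>n. A n (n - 1) \<noteq> 0"
    and Q: "spectral_polys A Q" and R: "spectral_polys A R"
  shows "Q = R"
proof (intro ext)
  fix \<eta> n
  have init: "Q \<eta> 0 = R \<eta> 0" "Q \<eta> (-1) = R \<eta> (-1)"
    using Q R exhaust_2[of \<eta>] by (auto simp: spectral_polys_def)
  have "poly (Q \<eta> n) x = poly (R \<eta> n) x" for x
    by (rule three_term_unique[of A x "\<lambda>n. poly (Q \<eta> n) x" "\<lambda>n. poly (R \<eta> n) x"])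
      (use nz spectral_polys_poly[OF Q] spectral_polys_poly[OF R] init in simp_all)
  then show "Q \<eta> n = R \<eta> n" by (simp add: poly_eq_poly_eq_iff[symmetric] fun_eq_iff)
qed

lemma potential_0: "potential A 0 = 1"
  by (simp add: potential_def)

lemma potential_step:
  assumes nz: "\<And>n. A n (n + 1) \<noteq> 0" "\<And>n. A n (n - 1) \<noteq> 0"
  shows "potential A (n + 1) = potential A n * A n (n + 1) / A (n + 1) n"
proof -
  have nz': "A (n + 1) n \<noteq> 0" using nz(2)[of "n + 1"] by simp
  consider "0 \<le> n" | "n = -1" | "n < -1" by linarith
  then show ?thesis
  proof cases
    case 1
    have "{0..n + 1 - 1} = insert n {0..n - 1}" "{1..n + 1} = insert (n + 1) {1..n}"
      using 1 by auto
    then show ?thesis using 1 by (simp add: potential_def mult.commute)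
  next
    case 2
    then show ?thesis using nz(1)[of "-1"] nz(2)[of 0] by (simp add: potential_def)
  next
    case 3
    have "{n + 1..0} = insert (n + 1) {n + 1 + 1..0}" "{n..-1} = insert n {n + 1..-1}"
      using 3 by auto
    then show ?thesis using 3 nz(1)[of n] nz' by (simp add: potential_def)
  qed
qed

section \<open>Integration against matrix measures\<close>

lemma mat2_quadform: "v \<bullet> (A *v w) = (\<Sum>i\<in>UNIV. \<Sum>j\<in>UNIV. v $ i * A $ i $ j * w $ j)"
  for A :: "real^2^2"
  by (simp add: inner_vec_def matrix_vector_mult_def sum_distrib_left mult.assoc)

lemma bounded_linear_quadform: "bounded_linear (\<lambda>A::real^2^2. v \<bullet> (A *v w))"
proof -
  have eq: "(\<lambda>A::real^2^2. v \<bullet> (A *v w)) = (\<lambda>A. \<Sum>i\<in>UNIV. \<Sum>j\<in>UNIV. (v $ i * w $ j) * A $ i $ j)"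
    by (simp add: mat2_quadform algebra_simps)
  show ?thesis unfolding eq
    by (intro bounded_linear_sum bounded_linear_const_mult bounded_linear_compose[OF bounded_linear_vec_nth]
        bounded_linear_vec_nth)
qed

lemma bounded_linear_entry: "bounded_linear (\<lambda>A::real^2^2. A $ i $ j)"
  by (rule bounded_linear_compose[OF bounded_linear_vec_nth bounded_linear_vec_nth])

lemma psd_symmetric: "psd A \<Longrightarrow> A $ i $ j = A $ j $ i"
proof -
  assume "psd A"
  then have "transpose A $ i $ j = A $ i $ j" by (simp add: psd_def)
  then show ?thesis by (simp add: transpose_def)
qed

lemma quadform_polarize:
  fixes A :: "real^2^2"
  assumes "A $ i $ j = A $ j $ i"
  shows "(axis i 1 + axis j 1) \<bullet> (A *v (axis i 1 + axis j 1))
       - (axis i 1 - axis j 1) \<bullet> (A *v (axis i 1 - axis j 1)) = 4 * A $ i $ j"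
  using assms exhaust_2[of i] exhaust_2[of j] by (auto simp: mat2_quadform sum_2 axis_def)

lemma matrix_measure_empty:
  assumes "matrix_measure M" shows "M {} = 0"
proof -
  have "(\<lambda>k::nat. M {}) sums M (\<Union>k::nat. {})"
    using assms[unfolded matrix_measure_def, THEN conjunct2, rule_format, of "\<lambda>_. {}"]
    by (simp add: disjoint_family_on_def image_subset_iff)
  then show ?thesis by (simp add: sums_iff summable_const_iff)
qed

lemma matrix_measure_sums:
  assumes "matrix_measure M" "range F \<subseteq> sets borel" "disjoint_family F"
  shows "(\<lambda>k. v \<bullet> (M (F k) *v v)) sums (v \<bullet> (M (\<Union>k. F k) *v v))"
  using assms bounded_linear.sums[OF bounded_linear_quadform] unfolding matrix_measure_def by blast

lemma sets_quad_measure [measurable_cong, simp]: "sets (quad_measure M v) = sets borel"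
  and space_quad_measure [simp]: "space (quad_measure M v) = UNIV"
  unfolding quad_measure_def using sets.sigma_sets_eq[of borel] by (simp_all add: sets_measure_of_conv space_measure_of_conv)

lemma emeasure_quad_measure:
  assumes M: "matrix_measure M" and A: "A \<in> sets borel"
  shows "emeasure (quad_measure M v) A = ennreal (v \<bullet> (M A *v v))"
proof (rule emeasure_measure_of[OF quad_measure_def])
  show "positive (sets (quad_measure M v)) (\<lambda>A. ennreal (v \<bullet> (M A *v v)))"
    by (simp add: positive_def matrix_measure_empty[OF M])
  show "countably_additive (sets (quad_measure M v)) (\<lambda>A. ennreal (v \<bullet> (M A *v v)))"
  proof (rule countably_additiveI)
    fix F :: "nat \<Rightarrow> real set"
    assume F: "range F \<subseteq> sets (quad_measure M v)" "disjoint_family F"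
    have "0 \<le> v \<bullet> (M (F k) *v v)" for k
      using M F unfolding matrix_measure_def psd_def by auto
    then show "(\<Sum>k. ennreal (v \<bullet> (M (F k) *v v))) = ennreal (v \<bullet> (M (\<Union> (range F)) *v v))"
      using matrix_measure_sums[OF M, of F v] F by (intro suminf_ennreal_eq) simp_all
  qed
qed (use A in auto)

lemma finite_quad_measure:
  assumes "matrix_measure M" shows "finite_measure (quad_measure M v)"
  by (rule finite_measureI) (simp add: emeasure_quad_measure[OF assms])

lemma measure_quad_measure:
  assumes "matrix_measure M" "A \<in> sets borel"
  shows "measure (quad_measure M v) A = v \<bullet> (M A *v v)"
  using assms by (simp add: measure_def emeasure_quad_measure matrix_measure_def psd_def)

lemma AE_quad_measure:
  assumes M: "matrix_measure M" and supp: "M (- {-1..1}) = 0"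
  shows "AE x in quad_measure M v. x \<in> {-1..1}"
  by (rule AE_I[of _ _ "- {-1..1}"]) (auto simp: emeasure_quad_measure[OF M] supp)

lemma integrable_quad_measure:
  fixes f :: "real \<Rightarrow> real"
  assumes M: "matrix_measure M" "M (- {-1..1}) = 0"
    and f: "f \<in> borel_measurable borel" "\<And>x. x \<in> {-1..1} \<Longrightarrow> \<bar>f x\<bar> \<le> B"
  shows "integrable (quad_measure M v) f"
proof -
  have "AE x in quad_measure M v. norm (f x) \<le> B"
    using AE_quad_measure[OF M] by eventually_elim (use f in auto)
  moreover have "f \<in> borel_measurable (quad_measure M v)"
    using f(1) by (simp cong: measurable_cong_sets)
  ultimately show ?thesis
    using finite_measure.integrable_const_bound[OF finite_quad_measure[OF M(1)]] by blast
qed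

lemma integrable_quad_measure_cont:
  assumes "matrix_measure M" "M (- {-1..1}) = 0" and f: "continuous_on UNIV (f :: real \<Rightarrow> real)"
  shows "integrable (quad_measure M v) f"
proof -
  have "bounded (f ` {-1..1})"
    by (intro compact_imp_bounded compact_continuous_image continuous_on_subset[OF f]) auto
  then obtain B where "\<forall>x\<in>{-1..1}. \<bar>f x\<bar> \<le> B" unfolding bounded_iff by auto
  then have "\<And>x. x \<in> {-1..1} \<Longrightarrow> \<bar>f x\<bar> \<le> B" by blast
  then show ?thesis
    using assms borel_measurable_continuous_onI[OF f] by (intro integrable_quad_measure)
qed

lemma entry_integral_zero [simp]: "entry_integral M i j (\<lambda>x. 0) = 0"
  by (simp add: entry_integral_def)

lemma entry_integral_scale [simp]: "entry_integral M i j (\<lambda>x. c * f x) = c * entry_integral M i j f"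
  by (simp add: entry_integral_def algebra_simps)

lemma entry_integral_add:
  assumes M: "matrix_measure M" "M (- {-1..1}) = 0"
    and "continuous_on UNIV f" "continuous_on UNIV g"
  shows "entry_integral M i j (\<lambda>x. f x + g x) = entry_integral M i j f + entry_integral M i j g"
  using assms by (simp add: entry_integral_def integrable_quad_measure_cont add_divide_distrib diff_divide_distrib)

lemma entry_integral_sum:
  assumes M: "matrix_measure M" "M (- {-1..1}) = 0"
    and "finite I" "\<And>k. k \<in> I \<Longrightarrow> continuous_on UNIV (f k)"
  shows "entry_integral M i j (\<lambda>x. \<Sum>k\<in>I. f k x) = (\<Sum>k\<in>I. entry_integral M i j (f k))"
  using assms(3,4)
proof (induction I rule: finite_induct)
  case (insert k I)
  have "continuous_on UNIV (\<lambda>x. \<Sum>k\<in>I. f k x)" using insert by (intro continuous_intros) auto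
  then show ?case using insert by (simp add: entry_integral_add[OF M])
qed simp

lemma entry_integral_indicator:
  assumes M: "matrix_measure M" and A: "A \<in> sets borel"
  shows "entry_integral M i j (indicator A) = M A $ i $ j"
proof -
  have "psd (M A)" using M A by (simp add: matrix_measure_def)
  then show ?thesis
    using A by (simp add: entry_integral_def measure_quad_measure[OF M] quadform_polarize psd_symmetric)
qed

text \<open>Dominated convergence passes to the signed entries because each is a difference of two finite measures. It serves twice: for uniform approximation by polynomials and for the approximation of half lines by continuous functions.\<close>

lemma entry_integral_tendsto:
  fixes g :: "nat \<Rightarrow> real \<Rightarrow> real"
  assumes M: "matrix_measure M" "M (- {-1..1}) = 0"
    and g: "\<And>n. g n \<in> borel_measurable borel" "f \<in> borel_measurable borel"
    and bd: "\<And>n x. x \<in> {-1..1} \<Longrightarrow> \<bar>g n x\<bar> \<le> B"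
    and lim: "\<And>x. x \<in> {-1..1} \<Longrightarrow> (\<lambda>n. g n x) \<longlonglongrightarrow> f x"
  shows "(\<lambda>n. entry_integral M i j (g n)) \<longlonglongrightarrow> entry_integral M i j f"
proof -
  have "(\<lambda>n. LINT x|quad_measure M v. g n x) \<longlonglongrightarrow> (LINT x|quad_measure M v. f x)" for v
  proof (rule integral_dominated_convergence[where w="\<lambda>_. B"])
    show "integrable (quad_measure M v) (\<lambda>_. B)"
      using finite_measure.integrable_const[OF finite_quad_measure[OF M(1)]] by blast
    show "AE x in quad_measure M v. (\<lambda>n. g n x) \<longlonglongrightarrow> f x"
      using AE_quad_measure[OF M] by eventually_elim (use lim in auto)
    show "AE x in quad_measure M v. norm (g n x) \<le> B" for n
      using AE_quad_measure[OF M] by eventually_elim (use bd in auto)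
  qed (use g in \<open>simp_all cong: measurable_cong_sets\<close>)
  then show ?thesis unfolding entry_integral_def by (intro tendsto_intros) auto
qed

section \<open>A spectral matrix is determined by its moments\<close>

lemma entry_integral_cont_eq:
  assumes M: "matrix_measure M" "M (- {-1..1}) = 0" and N: "matrix_measure N" "N (- {-1..1}) = 0"
    and mom: "\<And>k. entry_integral M i j (\<lambda>x. x ^ k) = entry_integral N i j (\<lambda>x. x ^ k)"
    and f: "continuous_on UNIV f"
  shows "entry_integral M i j f = entry_integral N i j f"
proof -
  have poly: "entry_integral M i j p = entry_integral N i j p" if p: "real_polynomial_function p" for p
  proof -
    obtain a n where p: "p = (\<lambda>x. \<Sum>k\<le>n. a k * x ^ k)"
      using p unfolding real_polynomial_function_iff_sum by blast
    have "continuous_on UNIV (\<lambda>x::real. a k * x ^ k)" for k by (intro continuous_intros)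
    then show ?thesis by (simp add: p entry_integral_sum[OF M] entry_integral_sum[OF N] mom)
  qed
  have "\<exists>p. real_polynomial_function p \<and> (\<forall>x\<in>{-1..1}. \<bar>f x - p x\<bar> < 1 / (real n + 1))" for n
    by (rule Stone_Weierstrass_real_polynomial_function[of "{-1..1}" f "1 / (real n + 1)"])
      (use continuous_on_subset[OF f] in auto)
  then obtain p where p: "\<And>n. real_polynomial_function (p n)"
    "\<And>n x. x \<in> {-1..1} \<Longrightarrow> \<bar>f x - p n x\<bar> < 1 / (real n + 1)" by metis
  have "bounded (f ` {-1..1})"
    by (intro compact_imp_bounded compact_continuous_image continuous_on_subset[OF f]) auto
  then obtain B where "\<forall>x\<in>{-1..1}. \<bar>f x\<bar> \<le> B" unfolding bounded_iff by auto
  then have B: "\<And>x. x \<in> {-1..1} \<Longrightarrow> \<bar>f x\<bar> \<le> B" by blast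
  have bd: "\<bar>p n x\<bar> \<le> B + 1" if "x \<in> {-1..1}" for n x
  proof -
    have "1 / (real n + 1) \<le> 1" by simp
    then show ?thesis using p(2)[OF that, of n] B[OF that] by linarith
  qed
  have lim: "(\<lambda>n. p n x) \<longlonglongrightarrow> f x" if "x \<in> {-1..1}" for x
  proof (rule LIMSEQ_I)
    fix r :: real assume "0 < r"
    then obtain m where m: "1 / (real m + 1) < r" by (metis add.commute inverse_eq_divide of_nat_Suc reals_Archimedean)
    have "norm (p n x - f x) < r" if "m \<le> n" for n
    proof -
      have "1 / (real n + 1) \<le> 1 / (real m + 1)" using that by (simp add: frac_le)
      then show ?thesis using p(2)[OF \<open>x \<in> {-1..1}\<close>, of n] m by (simp add: abs_minus_commute)
    qed
    then show "\<exists>m. \<forall>n\<ge>m. norm (p n x - f x) < r" by blast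
  qed
  have meas: "p n \<in> borel_measurable borel" "f \<in> borel_measurable borel" for n
    using p(1) f by (auto intro!: borel_measurable_continuous_onI continuous_on_polymonial_function
        simp: real_polynomial_function_eq)
  have "(\<lambda>n. entry_integral M i j (p n)) \<longlonglongrightarrow> entry_integral M i j f"
    by (rule entry_integral_tendsto[OF M meas bd lim])
  moreover have "(\<lambda>n. entry_integral N i j (p n)) \<longlonglongrightarrow> entry_integral N i j f"
    by (rule entry_integral_tendsto[OF N meas bd lim])
  ultimately show ?thesis
    using LIMSEQ_unique by (simp add: poly[OF p(1)])
qed

text \<open>The half lines are stable under intersection, so the usual Dynkin argument applies; it only uses countable additivity and hence works directly for matrix-valued set functions.\<close>

lemma matrix_measure_eqI:
  assumes M: "matrix_measure M" and N: "matrix_measure N"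
    and U: "M UNIV = N UNIV" and eq: "\<And>a. M {..a} = N {..a}"
    and A: "A \<in> sets borel"
  shows "M A = N A"
proof -
  have gen: "sets (borel :: real measure) = sigma_sets UNIV (range (\<lambda>a. {..a}))"
    by (subst borel_eq_atMost) simp
  have sums: "(\<lambda>k. M' (F k)) sums M' (\<Union>k. F k)"
    if "matrix_measure M'" "range F \<subseteq> sets borel" "disjoint_family F" for M' and F :: "nat \<Rightarrow> real set"
    using that by (simp add: matrix_measure_def)
  have diff: "M' (UNIV - B) = M' UNIV - M' B" if M': "matrix_measure M'" and B: "B \<in> sets borel" for M' B
  proof -
    define F where "F k = (if k = 0 then B else if k = 1 then UNIV - B else {})" for k :: nat
    have "(\<lambda>k. M' (F k)) sums M' (\<Union>k. F k)"
      using B by (intro sums[OF M']) (auto simp: F_def disjoint_family_on_def)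
    moreover have "(\<Union>k. F k) = UNIV" by (auto simp: F_def split: if_splits)
    moreover have "(\<lambda>k. M' (F k)) sums (\<Sum>k\<in>{0,1}. M' (F k))"
      by (rule sums_finite) (auto simp: F_def matrix_measure_empty[OF M'])
    ultimately have "M' UNIV = M' B + M' (UNIV - B)"
      using sums_unique2 by (fastforce simp: F_def)
    then show ?thesis by simp
  qed
  have "Int_stable (range (\<lambda>a::real. {..a}))" by (auto simp: Int_stable_def)
  moreover have "range (\<lambda>a::real. {..a}) \<subseteq> Pow UNIV" by simp
  moreover have "A \<in> sigma_sets UNIV (range (\<lambda>a. {..a}))" using A gen by simp
  ultimately show ?thesis
  proof (induction rule: sigma_sets_induct_disjoint)
    case (compl B)
    then have "B \<in> sets borel" by (simp add: gen)
    then show ?case using compl diff[OF M] diff[OF N] U by simp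
  next
    case (union F)
    then have "range F \<subseteq> sets borel" using gen by simp
    then have "(\<lambda>k. M (F k)) sums M (\<Union>k. F k)" "(\<lambda>k. N (F k)) sums N (\<Union>k. F k)"
      using union(1) sums M N by auto
    then show ?case using union(3) sums_unique2 by simp
  qed (use eq in \<open>auto simp: matrix_measure_empty[OF M] matrix_measure_empty[OF N]\<close>)
qed

lemma matrix_measure_determinate:
  assumes M: "matrix_measure M" "M (- {-1..1}) = 0" and N: "matrix_measure N" "N (- {-1..1}) = 0"
    and mom: "\<And>i j k. entry_integral M i j (\<lambda>x. x ^ k) = entry_integral N i j (\<lambda>x. x ^ k)"
    and A: "A \<in> sets borel"
  shows "M A = N A"
proof (rule matrix_measure_eqI[OF M(1) N(1) _ _ A])
  have cont: "entry_integral M i j f = entry_integral N i j f" if "continuous_on UNIV f" for i j f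
    by (rule entry_integral_cont_eq[OF M N mom that])
  have "M UNIV $ i $ j = N UNIV $ i $ j" for i j
  proof -
    have "indicator (UNIV :: real set) = (\<lambda>x. 1 :: real)" by auto
    then show ?thesis
      using cont[of "\<lambda>_. 1" i j] entry_integral_indicator[OF M(1), of UNIV i j]
        entry_integral_indicator[OF N(1), of UNIV i j] by simp
  qed
  then show "M UNIV = N UNIV" by (simp add: vec_eq_iff)
  fix a :: real
  \<comment> \<open>Continuous functions decreasing to the indicator of the half line.\<close>
  define g where "g n x = max 0 (1 - real n * max 0 (x - a))" for n x
  have g_cont: "continuous_on UNIV (g n)" for n unfolding g_def by (intro continuous_intros)
  have meas: "g n \<in> borel_measurable borel" "(indicator {..a} :: real \<Rightarrow> real) \<in> borel_measurable borel" for n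
    using borel_measurable_continuous_onI[OF g_cont] by simp_all
  have bd: "\<bar>g n x\<bar> \<le> 1" for n x by (simp add: g_def)
  have lim: "(\<lambda>n. g n x) \<longlonglongrightarrow> indicator {..a} x" for x
  proof (cases "x \<le> a")
    case True
    then show ?thesis by (simp add: g_def max_def)
  next
    case False
    then obtain m where m: "1 < real m * (x - a)" using reals_Archimedean3[of "x - a"] by auto
    have "g n x = 0" if "m \<le> n" for n
    proof -
      have "real m * (x - a) \<le> real n * (x - a)" using that False by (intro mult_right_mono) auto
      then have "1 \<le> real n * (x - a)" using m by linarith
      then show ?thesis using False by (simp add: g_def)
    qed
    then have "\<forall>\<^sub>F n in sequentially. g n x = 0" by (auto simp: eventually_sequentially)
    then show ?thesis using False by (simp add: tendsto_eventually)
  qed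
  have "M {..a} $ i $ j = N {..a} $ i $ j" for i j
  proof -
    have "(\<lambda>n. entry_integral M i j (g n)) \<longlonglongrightarrow> entry_integral M i j (indicator {..a})"
      by (rule entry_integral_tendsto[OF M meas bd lim])
    moreover have "(\<lambda>n. entry_integral N i j (g n)) \<longlonglongrightarrow> entry_integral N i j (indicator {..a})"
      by (rule entry_integral_tendsto[OF N meas bd lim])
    ultimately show ?thesis
      using LIMSEQ_unique by (simp add: cont[OF g_cont] entry_integral_indicator M(1) N(1))
  qed
  then show "M {..a} = N {..a}" by (simp add: vec_eq_iff)
qed

text \<open>Multiplying the orthogonality relations by \<open>x\<^sup>k\<close> and using the recurrence, every integral of \<open>x\<^sup>k Q\<^sub>i \<Psi> Q\<^sub>j\<^sup>T\<close> is determined by the matrix. For \<open>i\<close>, \<open>j\<close> in \<open>{0, -1}\<close> these are the moments of the four entries of \<open>\<Psi>\<close>.\<close>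

lemma spectral_matrix_unique:
  assumes nz: "\<And>n. A n (n + 1) \<noteq> 0" "\<And>n. A n (n - 1) \<noteq> 0"
    and SM: "spectral_matrix A M" and SN: "spectral_matrix A N" and B: "B \<in> sets borel"
  shows "M B = N B"
proof -
  obtain Q where M: "matrix_measure M" "M (- {-1..1}) = 0" and Q: "spectral_polys A Q"
    and QM: "\<And>i j. (\<Sum>\<eta>\<in>UNIV. \<Sum>\<xi>\<in>UNIV. entry_integral M \<eta> \<xi> (\<lambda>x. poly (Q \<eta> i) x * poly (Q \<xi> j) x))
              = (if i = j then 1 / potential A j else 0)"
    using SM by (auto simp: spectral_matrix_def)
  obtain R where N: "matrix_measure N" "N (- {-1..1}) = 0" and R: "spectral_polys A R"
    and RN: "\<And>i j. (\<Sum>\<eta>\<in>UNIV. \<Sum>\<xi>\<in>UNIV. entry_integral N \<eta> \<xi> (\<lambda>x. poly (R \<eta> i) x * poly (R \<xi> j) x))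
              = (if i = j then 1 / potential A j else 0)"
    using SN by (auto simp: spectral_matrix_def)
  have "R = Q" by (rule spectral_polys_unique[OF nz R Q])
  define m where "m M' k i j = (\<Sum>\<eta>\<in>UNIV. \<Sum>\<xi>\<in>UNIV.
      entry_integral M' \<eta> \<xi> (\<lambda>x. x ^ k * (poly (Q \<eta> i) x * poly (Q \<xi> j) x)))" for M' k i j
  have step: "m M' (Suc k) i j = A i (i + 1) * m M' k (i + 1) j + A i i * m M' k i j
      + A i (i - 1) * m M' k (i - 1) j" if M': "matrix_measure M'" "M' (- {-1..1}) = 0" for M' k i j
  proof -
    have "entry_integral M' \<eta> \<xi> (\<lambda>x. x ^ Suc k * (poly (Q \<eta> i) x * poly (Q \<xi> j) x))
       = A i (i + 1) * entry_integral M' \<eta> \<xi> (\<lambda>x. x ^ k * (poly (Q \<eta> (i + 1)) x * poly (Q \<xi> j) x))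
       + A i i * entry_integral M' \<eta> \<xi> (\<lambda>x. x ^ k * (poly (Q \<eta> i) x * poly (Q \<xi> j) x))
       + A i (i - 1) * entry_integral M' \<eta> \<xi> (\<lambda>x. x ^ k * (poly (Q \<eta> (i - 1)) x * poly (Q \<xi> j) x))"
      (is "?l = ?r") for \<eta> \<xi>
    proof -
      have "x ^ Suc k * (poly (Q \<eta> i) x * poly (Q \<xi> j) x)
        = A i (i + 1) * (x ^ k * (poly (Q \<eta> (i + 1)) x * poly (Q \<xi> j) x))
        + A i i * (x ^ k * (poly (Q \<eta> i) x * poly (Q \<xi> j) x))
        + A i (i - 1) * (x ^ k * (poly (Q \<eta> (i - 1)) x * poly (Q \<xi> j) x))" for x
      proof -
        have "x ^ Suc k * (poly (Q \<eta> i) x * poly (Q \<xi> j) x)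
            = x ^ k * poly (Q \<xi> j) x * (x * poly (Q \<eta> i) x)" by simp
        also have "\<dots> = x ^ k * poly (Q \<xi> j) x * (A i (i + 1) * poly (Q \<eta> (i + 1)) x
            + A i i * poly (Q \<eta> i) x + A i (i - 1) * poly (Q \<eta> (i - 1)) x)"
          by (subst spectral_polys_poly[OF Q, of x \<eta> i]) simp
        finally show ?thesis by (simp add: algebra_simps)
      qed
      then have "?l = entry_integral M' \<eta> \<xi> (\<lambda>x. A i (i + 1) * (x ^ k * (poly (Q \<eta> (i + 1)) x * poly (Q \<xi> j) x))
        + A i i * (x ^ k * (poly (Q \<eta> i) x * poly (Q \<xi> j) x))
        + A i (i - 1) * (x ^ k * (poly (Q \<eta> (i - 1)) x * poly (Q \<xi> j) x)))"
        by (simp only:)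
      also have "\<dots> = ?r"
        by (subst entry_integral_add[OF M'], (intro continuous_intros)+)+ simp
      finally show ?thesis .
    qed
    then show ?thesis unfolding m_def by (simp add: sum_2 algebra_simps)
  qed
  have meq: "m M k i j = m N k i j" for k i j
  proof (induction k arbitrary: i)
    case 0
    then show ?case using QM[of i j] RN[of i j] by (simp add: m_def \<open>R = Q\<close>)
  next
    case (Suc k)
    then show ?case by (simp add: step[OF M] step[OF N])
  qed
  have Q0: "Q 1 0 = 1" "Q 1 (-1) = 0" "Q 2 0 = 0" "Q 2 (-1) = 1"
    using Q by (simp_all add: spectral_polys_def)
  have "entry_integral M i j (\<lambda>x. x ^ k) = entry_integral N i j (\<lambda>x. x ^ k)" for i j k
    using meq[of k 0 0] meq[of k 0 "-1"] meq[of k "-1" 0] meq[of k "-1" "-1"] exhaust_2[of i] exhaust_2[of j]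
    by (auto simp: m_def sum_2 Q0)
  then show ?thesis by (rule matrix_measure_determinate[OF M N _ B])
qed

section \<open>Matrix measures with a density\<close>

lemma AE_nonneg_if_set_integrals_nonneg:
  fixes f :: "real \<Rightarrow> real"
  assumes f: "integrable lborel f" and nn: "\<And>A. A \<in> sets borel \<Longrightarrow> 0 \<le> (LINT x|lborel. indicator A x * f x)"
  shows "AE x in lborel. 0 \<le> f x"
proof -
  define A where "A = {x. f x < 0}"
  have [measurable]: "f \<in> borel_measurable borel" using f by simp
  have A: "A \<in> sets borel" unfolding A_def by measurable
  have int: "integrable lborel (\<lambda>x. indicator A x * f x)"
    using integrable_mult_indicator[of A lborel f] A f by simp
  have "(LINT x|lborel. - (indicator A x * f x)) \<le> 0" using nn[OF A] by simp
  moreover have "0 \<le> (LINT x|lborel. - (indicator A x * f x))"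
    by (rule integral_nonneg_AE) (auto simp: A_def indicator_def)
  ultimately have "(LINT x|lborel. - (indicator A x * f x)) = 0" by simp
  moreover have "AE x in lborel. 0 \<le> - (indicator A x * f x)" by (auto simp: A_def indicator_def)
  ultimately have "AE x in lborel. - (indicator A x * f x) = 0"
    using integral_nonneg_eq_0_iff_AE[of lborel "\<lambda>x. - (indicator A x * f x)"] int by simp
  then show ?thesis by eventually_elim (auto simp: A_def indicator_def split: if_splits)
qed

lemma quadform_nonneg_dense:
  fixes A :: "real^2^2"
  assumes D: "\<And>X. open X \<Longrightarrow> X \<noteq> {} \<Longrightarrow> \<exists>d\<in>D. d \<in> X" and nn: "\<And>v. v \<in> D \<Longrightarrow> 0 \<le> v \<bullet> (A *v v)"
  shows "0 \<le> v \<bullet> (A *v v)"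
proof (rule ccontr)
  assume "\<not> ?thesis"
  define X where "X = {v. v \<bullet> (A *v v) < 0}"
  have "open X" unfolding X_def mat2_quadform
    by (intro open_Collect_less continuous_intros)
  moreover have "v \<in> X" using \<open>\<not> _\<close> by (simp add: X_def)
  then have "X \<noteq> {}" by blast
  ultimately obtain d where "d \<in> D" "d \<in> X" using D by metis
  then show False using nn[of d] by (simp add: X_def)
qed

text \<open>For each fixed vector the quadratic form of the density is nonnegative almost everywhere. The exceptional null set depends on the vector, so countably many vectors forming a dense set are treated first and continuity gives the rest.\<close>

lemma density_psd_AE:
  fixes V :: "real \<Rightarrow> real^2^2"
  assumes V: "integrable lborel V"
    and psd: "\<And>A. A \<in> sets borel \<Longrightarrow> psd (LINT x:A|lborel. V x)"
  shows "AE x in lborel. psd (V x)"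
proof -
  have int: "(LINT x|lborel. indicator A x * T (V x)) = T (LINT x:A|lborel. V x)"
    if "A \<in> sets borel" "bounded_linear T" for A and T :: "real^2^2 \<Rightarrow> real"
  proof -
    interpret T: bounded_linear T by fact
    have "T (LINT x:A|lborel. V x) = (LINT x|lborel. T (indicator A x *\<^sub>R V x))"
      unfolding set_lebesgue_integral_def
      using integral_bounded_linear[OF that(2) integrable_mult_indicator[of A lborel V]] that(1) V by simp
    then show ?thesis by (simp add: T.scaleR)
  qed
  have quad: "AE x in lborel. 0 \<le> v \<bullet> (V x *v v)" for v
  proof (rule AE_nonneg_if_set_integrals_nonneg)
    show "integrable lborel (\<lambda>x. v \<bullet> (V x *v v))"
      by (rule integrable_bounded_linear[OF bounded_linear_quadform V])
    show "0 \<le> (LINT x|lborel. indicator A x * (v \<bullet> (V x *v v)))" if "A \<in> sets borel" for A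
      using int[OF that bounded_linear_quadform] psd[OF that] by (simp add: psd_def)
  qed
  have diff: "AE x in lborel. 0 \<le> V x $ i $ j - V x $ j $ i" for i j
  proof (rule AE_nonneg_if_set_integrals_nonneg)
    have bl: "bounded_linear (\<lambda>A::real^2^2. A $ i $ j - A $ j $ i)"
      by (intro bounded_linear_sub bounded_linear_entry)
    show "integrable lborel (\<lambda>x. V x $ i $ j - V x $ j $ i)"
      by (rule integrable_bounded_linear[OF bl V])
    show "0 \<le> (LINT x|lborel. indicator A x * (V x $ i $ j - V x $ j $ i))" if "A \<in> sets borel" for A
      using int[OF that bl] psd_symmetric[OF psd[OF that], of i j] by simp
  qed
  obtain D :: "(real^2) set" where D: "countable D" "\<And>X. open X \<Longrightarrow> X \<noteq> {} \<Longrightarrow> \<exists>d\<in>D. d \<in> X"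
    using countable_dense_exists by blast
  have "AE x in lborel. \<forall>v\<in>D. 0 \<le> v \<bullet> (V x *v v)"
    using D(1) quad by (simp add: AE_ball_countable)
  moreover have "AE x in lborel. V x $ 1 $ 2 = V x $ 2 $ 1"
    using diff[of 1 2] diff[of 2 1] by eventually_elim simp
  ultimately show ?thesis
  proof eventually_elim
    case (elim x)
    then have "0 \<le> v \<bullet> (V x *v v)" for v using quadform_nonneg_dense[OF D(2)] by blast
    moreover have "transpose (V x) = V x" using elim by (simp add: vec_eq_iff forall_2 transpose_def)
    ultimately show ?case by (simp add: psd_def)
  qed
qed

lemma integral_quadform:
  fixes V :: "real \<Rightarrow> real^2^2"
  assumes "integrable lborel V" "A \<in> sets borel"
  shows "v \<bullet> ((LINT x:A|lborel. V x) *v v) = (LINT x|lborel. indicator A x * (v \<bullet> (V x *v v)))"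
proof -
  interpret T: bounded_linear "\<lambda>A::real^2^2. v \<bullet> (A *v v)" by (rule bounded_linear_quadform)
  show ?thesis
    unfolding set_lebesgue_integral_def
    using integral_bounded_linear[OF bounded_linear_quadform integrable_mult_indicator[of A lborel V], of v v] assms
    by (simp add: T.scaleR)
qed

lemma matrix_measure_density:
  fixes V :: "real \<Rightarrow> real^2^2"
  assumes V: "integrable lborel V" and psd: "AE x in lborel. psd (V x)"
  shows "matrix_measure (\<lambda>A. LINT x:A|lborel. V x)"
  unfolding matrix_measure_def
proof (intro conjI ballI allI impI)
  fix A :: "real set" assume A: "A \<in> sets borel"
  have int: "integrable lborel (\<lambda>x. indicator A x *\<^sub>R V x)"
    using integrable_mult_indicator[of A lborel V] A V by simp
  have "(LINT x:A|lborel. V x) $ i $ j = (LINT x:A|lborel. V x) $ j $ i" for i j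
  proof -
    have "(LINT x:A|lborel. V x) $ i $ j = (LINT x|lborel. (indicator A x *\<^sub>R V x) $ i $ j)" for i j
      unfolding set_lebesgue_integral_def using integral_bounded_linear[OF bounded_linear_entry int] by simp
    moreover have "(LINT x|lborel. (indicator A x *\<^sub>R V x) $ i $ j) = (LINT x|lborel. (indicator A x *\<^sub>R V x) $ j $ i)"
    proof (rule integral_cong_AE)
      show "AE x in lborel. (indicat_real A x *\<^sub>R V x) $ i $ j = (indicat_real A x *\<^sub>R V x) $ j $ i"
        using psd by eventually_elim (simp add: psd_symmetric[of "V _" i j])
    qed (use integrable_bounded_linear[OF bounded_linear_entry int] in \<open>blast intro: borel_measurable_integrable\<close>)+
    ultimately show ?thesis by simp
  qed
  moreover have "0 \<le> v \<bullet> ((LINT x:A|lborel. V x) *v v)" for v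
    unfolding integral_quadform[OF V A]
  proof (rule integral_nonneg_AE)
    show "AE x in lborel. 0 \<le> indicat_real A x * (v \<bullet> (V x *v v))"
      using psd by eventually_elim (simp add: psd_def)
  qed
  ultimately show "psd (LINT x:A|lborel. V x)"
    by (simp add: psd_def vec_eq_iff transpose_def)
next
  fix F :: "nat \<Rightarrow> real set" assume F: "range F \<subseteq> sets borel" "disjoint_family F"
  show "(\<lambda>k. LINT x:F k|lborel. V x) sums (LINT x:(\<Union>k. F k)|lborel. V x)"
  proof -
    have Fm: "F k \<in> sets borel" for k using F by auto
    have UF: "(\<Union>k. F k) \<in> sets borel" using Fm by blast
    define G where "G n = (\<Union>k<n. F k)" for n
    have Gm: "G n \<in> sets borel" for n using Fm by (auto simp: G_def)
    have G: "(LINT x:G n|lborel. V x) = (\<Sum>k<n. LINT x:F k|lborel. V x)" for n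
    proof -
      have "indicator (G n) x *\<^sub>R V x = (\<Sum>k<n. indicator (F k) x *\<^sub>R V x)" for x
      proof -
        have "indicator (\<Union>k\<in>{..<n}. F k) x = (\<Sum>k<n. indicator (F k) x :: real)"
          by (rule indicator_UN_disjoint) (use F(2) in \<open>auto simp: disjoint_family_on_def\<close>)
        then show ?thesis by (simp add: G_def scaleR_sum_left)
      qed
      moreover have "integrable lborel (\<lambda>x. indicator (F k) x *\<^sub>R V x)" for k
        using integrable_mult_indicator[of "F k" lborel V] Fm V by simp
      ultimately show ?thesis unfolding set_lebesgue_integral_def by (simp only:) (rule Bochner_Integration.integral_sum)
    qed
    have meas: "(\<lambda>x. indicat_real A x *\<^sub>R V x) \<in> borel_measurable lborel" if "A \<in> sets borel" for A
      by (rule borel_measurable_integrable[OF integrable_mult_indicator[OF _ V]]) (use that in simp)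
    have "(\<lambda>n. LINT x|lborel. indicator (G n) x *\<^sub>R V x) \<longlonglongrightarrow> (LINT x|lborel. indicator (\<Union>k. F k) x *\<^sub>R V x)"
    proof (rule integral_dominated_convergence[where w="\<lambda>x. norm (V x)"])
      show "AE x in lborel. (\<lambda>n. indicat_real (G n) x *\<^sub>R V x) \<longlonglongrightarrow> indicat_real (\<Union>k. F k) x *\<^sub>R V x"
      proof (rule AE_I2)
        fix x
        have "(\<lambda>n. indicat_real (\<Union>k<n. F k) x) \<longlonglongrightarrow> indicat_real (\<Union>k. F k) x"
          by (rule LIMSEQ_indicator_UN)
        then show "(\<lambda>n. indicat_real (G n) x *\<^sub>R V x) \<longlonglongrightarrow> indicat_real (\<Union>k. F k) x *\<^sub>R V x"
          unfolding G_def by (intro tendsto_intros)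
      qed
      show "(\<lambda>x. indicat_real (\<Union>k. F k) x *\<^sub>R V x) \<in> borel_measurable lborel"
        by (rule meas[OF UF])
      show "(\<lambda>x. indicat_real (G n) x *\<^sub>R V x) \<in> borel_measurable lborel" for n
        by (rule meas[OF Gm])
    qed (use V in \<open>auto simp: indicator_def\<close>)
    then have "(\<lambda>n. LINT x:G n|lborel. V x) \<longlonglongrightarrow> (LINT x:(\<Union>k. F k)|lborel. V x)"
      by (simp add: set_lebesgue_integral_def)
    then show ?thesis by (simp add: sums_def G)
  qed
qed

text \<open>The quadratic forms of a matrix measure with density are themselves measures with density, so polarization of the measures reduces to polarization of a symmetric matrix under the integral.\<close>

lemma entry_integral_density:
  fixes V :: "real \<Rightarrow> real^2^2"
  assumes M: "\<And>A. A \<in> sets borel \<Longrightarrow> M A = (LINT x:A|lborel. V x)"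
    and V: "integrable lborel V" and psd: "AE x in lborel. psd (V x)"
    and f: "f \<in> borel_measurable borel"
    and int: "\<And>i j. integrable lborel (\<lambda>x. f x * V x $ i $ j)"
  shows "entry_integral M i j f = (LINT x|lborel. f x * V x $ i $ j)"
proof -
  have quad: "quad_measure M v = density lborel (\<lambda>x. ennreal (v \<bullet> (V x *v v)))" (is "_ = ?N") for v
  proof -
    have iq: "integrable lborel (\<lambda>x. v \<bullet> (V x *v v))"
      by (rule integrable_bounded_linear[OF bounded_linear_quadform V])
    have "ennreal (v \<bullet> (M A *v v)) = emeasure ?N A" if A: "A \<in> sets borel" for A
    proof -
      have "emeasure ?N A = (\<integral>\<^sup>+x. ennreal (v \<bullet> (V x *v v)) * indicator A x \<partial>lborel)"
        using A borel_measurable_integrable[OF iq] by (subst emeasure_density) auto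
      also have "\<dots> = (\<integral>\<^sup>+x. ennreal (indicator A x * (v \<bullet> (V x *v v))) \<partial>lborel)"
        by (intro nn_integral_cong) (auto simp: indicator_def)
      also have "\<dots> = ennreal (LINT x|lborel. indicator A x * (v \<bullet> (V x *v v)))"
      proof (rule nn_integral_eq_integral)
        show "integrable lborel (\<lambda>x. indicat_real A x * (v \<bullet> (V x *v v)))"
          using integrable_mult_indicator[of A lborel, OF _ iq] A by simp
        show "AE x in lborel. 0 \<le> indicat_real A x * (v \<bullet> (V x *v v))"
          using psd by eventually_elim (simp add: psd_def)
      qed
      finally show ?thesis using A by (simp add: M integral_quadform[OF V])
    qed
    moreover have "sigma_sets UNIV (sets borel) = (sets borel :: real set set)"
      using sets.sigma_sets_eq[of "borel :: real measure"] by simp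
    ultimately have "quad_measure M v = measure_of UNIV (sets borel) (emeasure ?N)"
      unfolding quad_measure_def by (intro measure_of_eq) auto
    also have "\<dots> = ?N" using measure_of_of_measure[of ?N] by simp
    finally show ?thesis .
  qed
  have intq: "integrable lborel (\<lambda>x. (v \<bullet> (V x *v v)) * f x)" for v
  proof -
    have "(\<lambda>x. (v \<bullet> (V x *v v)) * f x) = (\<lambda>x. \<Sum>i\<in>UNIV. \<Sum>j\<in>UNIV. (v $ i * v $ j) * (f x * V x $ i $ j))"
      by (simp add: mat2_quadform sum_2 algebra_simps)
    then show ?thesis using int by simp
  qed
  have lint: "(LINT x|quad_measure M v. f x) = (LINT x|lborel. (v \<bullet> (V x *v v)) * f x)" for v
  proof -
    have "(\<lambda>x. v \<bullet> (V x *v v)) \<in> borel_measurable lborel"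
      using integrable_bounded_linear[OF bounded_linear_quadform V] by (rule borel_measurable_integrable)
    moreover have "AE x in lborel. 0 \<le> v \<bullet> (V x *v v)"
      using psd by eventually_elim (simp add: psd_def)
    ultimately show ?thesis unfolding quad using f by (subst integral_density) auto
  qed
  let ?u = "axis i 1 + axis j 1 :: real^2" and ?w = "axis i 1 - axis j 1 :: real^2"
  have "entry_integral M i j f = (LINT x|lborel. ((?u \<bullet> (V x *v ?u)) * f x - (?w \<bullet> (V x *v ?w)) * f x) / 4)"
    using intq unfolding entry_integral_def lint by simp
  also have "\<dots> = (LINT x|lborel. f x * V x $ i $ j)"
  proof (rule integral_cong_AE)
    show "AE x in lborel. ((?u \<bullet> (V x *v ?u)) * f x - (?w \<bullet> (V x *v ?w)) * f x) / 4 = f x * V x $ i $ j"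
      using psd
    proof eventually_elim
      case (elim x)
      have "(?u \<bullet> (V x *v ?u)) * f x - (?w \<bullet> (V x *v ?w)) * f x
        = (?u \<bullet> (V x *v ?u) - ?w \<bullet> (V x *v ?w)) * f x" by (simp add: left_diff_distrib)
      then show ?case by (simp add: quadform_polarize psd_symmetric[OF elim])
    qed
  qed (use intq int in \<open>auto intro!: borel_measurable_integrable\<close>)
  finally show ?thesis .
qed

lemma integrable_cont_mult:
  fixes f g :: "real \<Rightarrow> real"
  assumes f: "integrable lborel f" "\<And>x. x \<notin> {0..1} \<Longrightarrow> f x = 0" and g: "continuous_on UNIV g"
  shows "integrable lborel (\<lambda>x. g x * f x)"
proof -
  have "bounded (g ` {0..1})"
    by (intro compact_imp_bounded compact_continuous_image continuous_on_subset[OF g]) auto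
  then obtain B where B: "\<forall>x\<in>{0..1}. \<bar>g x\<bar> \<le> B" unfolding bounded_iff by auto
  show ?thesis
  proof (rule Bochner_Integration.integrable_bound)
    show "integrable lborel (\<lambda>x. B * f x)" using f by simp
    show "AE x in lborel. norm (g x * f x) \<le> norm (B * f x)"
    proof (rule AE_I2)
      fix x
      show "norm (g x * f x) \<le> norm (B * f x)"
      proof (cases "x \<in> {0..1}")
        case True
        then have "\<bar>g x\<bar> \<le> \<bar>B\<bar>" using B by force
        then show ?thesis by (simp add: abs_mult mult_right_mono)
      qed (simp add: f(2))
    qed
  qed (use borel_measurable_continuous_onI[OF g] f(1) in auto)
qed

lemma integrable_cont_form:
  fixes V :: "real \<Rightarrow> real^2^2" and F G :: "real \<Rightarrow> real^2"
  assumes V: "integrable lborel V" "\<And>x. x \<notin> {0..1} \<Longrightarrow> V x = 0"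
    and F: "continuous_on UNIV F" and G: "continuous_on UNIV G"
  shows "integrable lborel (\<lambda>x. F x \<bullet> (V x *v G x))"
proof -
  have "integrable lborel (\<lambda>x. (F x $ i * G x $ j) * V x $ i $ j)" for i j
    by (rule integrable_cont_mult[OF integrable_bounded_linear[OF bounded_linear_entry V(1)]])
      (use V(2) F G in \<open>auto intro!: continuous_intros\<close>)
  then have "integrable lborel (\<lambda>x. \<Sum>i\<in>UNIV. \<Sum>j\<in>UNIV. (F x $ i * G x $ j) * V x $ i $ j)" by simp
  then show ?thesis by (simp add: mat2_quadform mult_ac)
qed

section \<open>Discrete Darboux transformations\<close>

text \<open>The bidiagonal factors: \<open>L\<close> has \<open>x\<close> on and \<open>y\<close> below the diagonal, \<open>U\<close> has the entries \<open>t\<^sub>n\<^sub>+\<^sub>1\<close> on and \<open>s\<^sub>n\<^sub>+\<^sub>1\<close> above the diagonal in row \<open>n\<close>.\<close>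

locale LU_factors =
  fixes x y s t :: "int \<Rightarrow> real"
  assumes pos: "\<And>n. 0 < x n" "\<And>n. 0 < y n" "\<And>n. 0 < s n" "\<And>n. 0 < t n"
begin

lemma nz [simp]: "x n \<noteq> 0" "y n \<noteq> 0" "s n \<noteq> 0" "t n \<noteq> 0"
  using pos[of n] by simp_all

definition LU :: "int \<Rightarrow> int \<Rightarrow> real" where
  "LU i j = (if j = i + 1 then x i * s (i + 1) else if j = i then x i * t (i + 1) + y i * s i
     else if j = i - 1 then y i * t i else 0)"

definition UL :: "int \<Rightarrow> int \<Rightarrow> real" where
  "UL i j = (if j = i + 1 then s (i + 1) * x (i + 1)
     else if j = i then t (i + 1) * x i + s (i + 1) * y (i + 1)
     else if j = i - 1 then t (i + 1) * y i else 0)"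

lemma LU_simps [simp]: "LU n (n + 1) = x n * s (n + 1)" "LU n (n - 1) = y n * t n"
    "LU n n = x n * t (n + 1) + y n * s n" "LU (n + 1) n = y (n + 1) * t (n + 1)"
  by (simp_all add: LU_def)

lemma UL_simps [simp]: "UL n (n + 1) = s (n + 1) * x (n + 1)" "UL n (n - 1) = t (n + 1) * y n"
    "UL n n = t (n + 1) * x n + s (n + 1) * y (n + 1)" "UL (n + 1) n = t (n + 1 + 1) * y (n + 1)"
  by (simp_all add: UL_def)

definition w :: "int \<Rightarrow> real" where "w = potential LU"

definition wh :: "int \<Rightarrow> real" where "wh = potential UL"

lemma w_step: "w (n + 1) = w n * x n * s (n + 1) / (y (n + 1) * t (n + 1))"
  using potential_step[of LU n] by (simp add: w_def mult.assoc)

lemma wh_step: "wh (n + 1) = wh n * s (n + 1) * x (n + 1) / (t (n + 1 + 1) * y (n + 1))"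
  using potential_step[of UL n] by (simp add: wh_def mult.assoc)

lemma wh_pos: "0 < wh n"
  unfolding wh_def potential_def using pos
  by (auto intro!: divide_pos_pos prod_pos mult_pos_pos simp: UL_def)

lemma w_pos: "0 < w n"
  unfolding w_def potential_def using pos
  by (auto intro!: divide_pos_pos prod_pos mult_pos_pos simp: LU_def)

definition c :: real where "c = x 0 / t 1"

lemma c_pos: "0 < c" using pos by (simp add: c_def)

text \<open>Up to the constant \<open>c\<close>, \<open>L\<close> is the adjoint of \<open>U\<close> for the weights given by the two potentials. This identity is the diagonal part of that statement; the next two lemmas put it in the form in which both bands are used.\<close>

lemma wh_eq: "c * wh n * t (n + 1) = w n * x n"
proof -
  have *: "c * wh (n + 1) * t (n + 1 + 1) = w (n + 1) * x (n + 1) \<longleftrightarrow> c * wh n * t (n + 1) = w n * x n" for n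
  proof -
    have "c * wh (n + 1) * t (n + 1 + 1) = c * wh n * t (n + 1) * (s (n + 1) * x (n + 1) / (t (n + 1) * y (n + 1)))"
      by (simp add: wh_step)
    moreover have "w (n + 1) * x (n + 1) = w n * x n * (s (n + 1) * x (n + 1) / (t (n + 1) * y (n + 1)))"
      unfolding w_step by (simp add: mult_ac)
    moreover have "s (n + 1) * x (n + 1) / (t (n + 1) * y (n + 1)) \<noteq> 0" by simp
    ultimately show ?thesis using mult_right_cancel by metis
  qed
  have 0: "c * wh 0 * t (0 + 1) = w 0 * x 0"
    by (simp add: wh_def w_def potential_0 c_def)
  show ?thesis
  proof (induction n rule: int_step_induct)
    case neg
    show ?case using *[of "-1"] 0 by simp
  next
    case (step n)
    then show ?case using *[of n] by simp
  next
    case (down n)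
    then show ?case using *[of "n - 1"] by simp
  qed (use 0 in simp)
qed

lemma adjoint_diag: "t (n + 1) / w n = x n / (c * wh n)"
  using wh_eq[of n] w_pos[of n] wh_pos[of n] c_pos by (simp add: field_simps)

lemma adjoint_offdiag: "s (n + 1) / w (n + 1) = y (n + 1) / (c * wh n)"
proof -
  have "s (n + 1) / w (n + 1) = y (n + 1) * (t (n + 1) / (w n * x n))"
    using w_pos[of n] by (simp add: w_step)
  also have "t (n + 1) / (w n * x n) = 1 / (c * wh n)"
    using wh_pos[of n] c_pos by (simp add: wh_eq[symmetric])
  finally show ?thesis by simp
qed

end

text \<open>Here \<open>V\<close> is the spectral density of \<open>L U\<close>, extended by \<open>0\<close> outside \<open>[0, 1]\<close>, and \<open>q\<^sub>n\<close> the vector of the two polynomials of index \<open>n\<close>. The last assumption says that a solution of \<open>L f = 0\<close> is not square summable towards \<open>+\<infinity>\<close>, with weights \<open>wh\<close>.\<close>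

locale darboux = LU_factors +
  fixes V :: "real \<Rightarrow> real^2^2" and q :: "int \<Rightarrow> real \<Rightarrow> real^2"
  assumes V_int: "integrable lborel V" and V_psd: "AE z in lborel. psd (V z)"
    and V_supp: "\<And>z. z \<notin> {0..1} \<Longrightarrow> V z = 0"
    and q_cont: "\<And>n. continuous_on UNIV (q n)"
    and q_rec: "\<And>n z. z *\<^sub>R q n z = LU n (n + 1) *\<^sub>R q (n + 1) z + LU n n *\<^sub>R q n z + LU n (n - 1) *\<^sub>R q (n - 1) z"
    and q_orth: "\<And>i j. (LINT z|lborel. q i z \<bullet> (V z *v q j z)) = (if i = j then 1 / w j else 0)"
    and kernel_free: "\<not> summable (\<lambda>n. (\<Prod>k<n. (y (int k + 1) / x (int k + 1))\<^sup>2) * wh (int n))"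
begin

abbreviation b :: "real \<Rightarrow> real^2 \<Rightarrow> real^2 \<Rightarrow> real" where
  "b z u v \<equiv> u \<bullet> (V z *v v)"

lemma b_linear:
  "b z (u + u') v = b z u v + b z u' v" "b z u (v + v') = b z u v + b z u v'"
  "b z (r *\<^sub>R u) v = r * b z u v" "b z u (r *\<^sub>R v) = r * b z u v"
  by (simp_all add: inner_add_left inner_add_right matrix_vector_right_distrib matrix_vector_mult_scaleR)

lemma b_int: "continuous_on UNIV F \<Longrightarrow> continuous_on UNIV G \<Longrightarrow> integrable lborel (\<lambda>z. b z (F z) (G z))"
  by (rule integrable_cont_form[OF V_int V_supp])

lemma b_int_mult:
  assumes "continuous_on UNIV g" "continuous_on UNIV F" "continuous_on UNIV G"
  shows "integrable lborel (\<lambda>z. g z * b z (F z) (G z))"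
  by (rule integrable_cont_mult[OF b_int _ assms(1)]) (use assms V_supp in auto)

lemma b_AE: "AE z in lborel. \<forall>u v. b z u v = b z v u \<and> 0 \<le> b z u u"
  using V_psd
proof eventually_elim
  case (elim z)
  have "b z u v = b z v u" for u v
    using psd_symmetric[OF elim, of 1 2] by (simp add: mat2_quadform sum_2 algebra_simps)
  then show ?case using elim by (simp add: psd_def)
qed

definition qh :: "int \<Rightarrow> real \<Rightarrow> real^2" where
  "qh n z = t (n + 1) *\<^sub>R q n z + s (n + 1) *\<^sub>R q (n + 1) z"

lemma qh_cont [continuous_intros]: "continuous_on A (qh n)"
  unfolding qh_def by (intro continuous_intros continuous_on_subset[OF q_cont]) auto

lemma qh_lower: "z *\<^sub>R q n z = x n *\<^sub>R qh n z + y n *\<^sub>R qh (n - 1) z"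
  by (simp add: q_rec qh_def scaleR_add_right scaleR_add_left)

lemma qh_rec: "z *\<^sub>R qh n z = UL n (n + 1) *\<^sub>R qh (n + 1) z + UL n n *\<^sub>R qh n z + UL n (n - 1) *\<^sub>R qh (n - 1) z"
proof -
  have "z *\<^sub>R qh n z = t (n + 1) *\<^sub>R (z *\<^sub>R q n z) + s (n + 1) *\<^sub>R (z *\<^sub>R q (n + 1) z)"
    by (simp add: qh_def scaleR_add_right mult.commute)
  then show ?thesis by (simp add: qh_lower scaleR_add_right scaleR_add_left)
qed

lemma q_qh_inner:
  "(LINT z|lborel. b z (q i z) (qh j z)) = (if j = i then x i else if j = i - 1 then y i else 0) / (c * wh j)"
proof -
  have eq: "(LINT z|lborel. b z (q i z) (qh j z))
      = t (j + 1) * (LINT z|lborel. b z (q i z) (q j z)) + s (j + 1) * (LINT z|lborel. b z (q i z) (q (j + 1) z))"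
    using b_int[OF q_cont q_cont] by (simp add: qh_def b_linear)
  consider "i = j" | "i = j + 1" | "i \<noteq> j" "i \<noteq> j + 1" by blast
  then show ?thesis
    unfolding eq q_orth by cases (use adjoint_diag[of j] adjoint_offdiag[of j] in simp_all)
qed

lemma qh_gram: "(LINT z|lborel. b z (qh i z) (qh j z)) = UL i j / (c * wh j)"
proof -
  have "(LINT z|lborel. b z (qh i z) (qh j z))
      = t (i + 1) * (LINT z|lborel. b z (q i z) (qh j z)) + s (i + 1) * (LINT z|lborel. b z (q (i + 1) z) (qh j z))"
    using b_int[OF q_cont qh_cont] by (simp add: qh_def[of i] b_linear)
  then show ?thesis by (simp add: q_qh_inner UL_def add_divide_distrib)
qed

text \<open>The polynomials \<open>p\<^sub>n\<close> increase to \<open>1/z\<close> on \<open>(0, 1]\<close> and satisfy \<open>z p\<^sub>n(z) = 1 - (1 - z)\<^sup>n\<close>. Consequently \<open>E n\<close> is the matrix \<open>(I - U L)\<^sup>n\<close> with its columns divided by the weights \<open>wh\<close>, and the next lemmas prove for \<open>E\<close> the corresponding facts: recursion, symmetry and the rule for the product of two powers. Defining it by integrals avoids powers of infinite matrices.\<close>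

definition p :: "nat \<Rightarrow> real \<Rightarrow> real" where "p n z = (\<Sum>k<n. (1 - z) ^ k)"

definition E :: "nat \<Rightarrow> int \<Rightarrow> int \<Rightarrow> real" where
  "E n i j = (if i = j then 1 / wh j else 0) - c * (LINT z|lborel. p n z * b z (qh i z) (qh j z))"

lemma p_int: "integrable lborel (\<lambda>z. p n z * b z (qh i z) (qh j z))"
  by (intro b_int_mult qh_cont) (auto simp: p_def intro!: continuous_intros)

lemma E_0: "E 0 i j = (if i = j then 1 / wh j else 0)"
  by (simp add: E_def p_def)

lemma E_Suc: "E (Suc n) i j = E n i j
    - (UL i (i + 1) * E n (i + 1) j + UL i i * E n i j + UL i (i - 1) * E n (i - 1) j)"
proof -
  let ?I = "\<lambda>k. LINT z|lborel. p n z * b z (qh k z) (qh j z)"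
  have p_Suc: "p (Suc n) z = 1 + (1 - z) * p n z" for z
    unfolding p_def sum.lessThan_Suc_shift by (simp add: sum_distrib_left)
  have "p (Suc n) z * b z (qh i z) (qh j z) = b z (qh i z) (qh j z) + p n z * b z (qh i z) (qh j z)
     - (UL i (i + 1) * (p n z * b z (qh (i + 1) z) (qh j z)) + UL i i * (p n z * b z (qh i z) (qh j z))
        + UL i (i - 1) * (p n z * b z (qh (i - 1) z) (qh j z)))" for z
  proof -
    have "z * b z (qh i z) (qh j z) = b z (UL i (i + 1) *\<^sub>R qh (i + 1) z + UL i i *\<^sub>R qh i z
        + UL i (i - 1) *\<^sub>R qh (i - 1) z) (qh j z)"
      by (simp only: qh_rec[symmetric] b_linear)
    also have "\<dots> = UL i (i + 1) * b z (qh (i + 1) z) (qh j z) + UL i i * b z (qh i z) (qh j z)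
        + UL i (i - 1) * b z (qh (i - 1) z) (qh j z)"
      by (simp only: b_linear)
    finally have z: "z * b z (qh i z) (qh j z) = \<dots>" .
    have "p (Suc n) z * b z (qh i z) (qh j z) = b z (qh i z) (qh j z) + p n z * b z (qh i z) (qh j z)
        - p n z * (z * b z (qh i z) (qh j z))"
      unfolding p_Suc by (simp only: algebra_simps)
    then show ?thesis unfolding z by (simp only: algebra_simps)
  qed
  then have eq: "(LINT z|lborel. p (Suc n) z * b z (qh i z) (qh j z)) = UL i j / (c * wh j) + ?I i
     - (UL i (i + 1) * ?I (i + 1) + UL i i * ?I i + UL i (i - 1) * ?I (i - 1))"
    using b_int[OF qh_cont qh_cont] p_int by (simp add: qh_gram del: UL_simps)
  have "c * (UL i j / (c * wh j)) = UL i j / wh j" using c_pos by simp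
  moreover have "c * (LINT z|lborel. p (Suc n) z * b z (qh i z) (qh j z)) = c * (UL i j / (c * wh j)) + c * ?I i
     - (UL i (i + 1) * (c * ?I (i + 1)) + UL i i * (c * ?I i) + UL i (i - 1) * (c * ?I (i - 1)))"
    unfolding eq by (simp only: algebra_simps)
  ultimately have "c * (LINT z|lborel. p (Suc n) z * b z (qh i z) (qh j z)) = UL i j / wh j + c * ?I i
     - (UL i (i + 1) * (c * ?I (i + 1)) + UL i i * (c * ?I i) + UL i (i - 1) * (c * ?I (i - 1)))"
    by (simp only:)
  moreover have "UL i j / wh j = UL i (i + 1) * (if i + 1 = j then 1 / wh j else 0)
      + UL i i * (if i = j then 1 / wh j else 0) + UL i (i - 1) * (if i - 1 = j then 1 / wh j else 0)"
    by (auto simp: UL_def)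
  ultimately show ?thesis
    unfolding E_def by (simp add: algebra_simps del: UL_simps)
qed

lemma E_sym: "E n i j = E n j i"
proof -
  have "(LINT z|lborel. p n z * b z (qh i z) (qh j z)) = (LINT z|lborel. p n z * b z (qh j z) (qh i z))"
  proof (rule integral_cong_AE)
    show "AE z in lborel. p n z * b z (qh i z) (qh j z) = p n z * b z (qh j z) (qh i z)"
      using b_AE by eventually_elim simp
  qed (use p_int in \<open>blast intro: borel_measurable_integrable\<close>)+
  then show ?thesis by (auto simp: E_def)
qed

text \<open>The product rule for powers of the band matrix \<open>I - U L\<close>. Row \<open>i\<close> of the \<open>m\<close>-th power lives on \<open>[i - m, i + m]\<close>, so the infinite matrix product is a sum over any finite \<open>K\<close> containing that interval.\<close>

lemma E_add:
  assumes "finite K" "{i - int m..i + int m} \<subseteq> K"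
  shows "E (m + n) i j = (\<Sum>k\<in>K. E m i k * wh k * E n k j)"
  using assms(2)
proof (induction m arbitrary: i)
  case 0
  then have "i \<in> K" by simp
  have "(\<Sum>k\<in>K. E 0 i k * wh k * E n k j) = (\<Sum>k\<in>K. if k = i then E n k j else 0)"
    using wh_pos by (intro sum.cong) (auto simp: E_0 less_imp_neq[symmetric])
  then show ?case using \<open>i \<in> K\<close> assms(1) by simp
next
  case (Suc m)
  have IH: "E (m + n) i' j = (\<Sum>k\<in>K. E m i' k * wh k * E n k j)" if "i' \<in> {i - 1, i, i + 1}" for i'
    by (rule Suc.IH) (use that Suc.prems in auto)
  have "E (Suc m + n) i j = E (m + n) i j
    - (UL i (i + 1) * E (m + n) (i + 1) j + UL i i * E (m + n) i j + UL i (i - 1) * E (m + n) (i - 1) j)"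
    by (simp only: add_Suc E_Suc)
  also have "\<dots> = (\<Sum>k\<in>K. E (Suc m) i k * wh k * E n k j)"
    by (simp add: IH E_Suc[of m] sum_distrib_left sum.distrib sum_subtractf algebra_simps del: UL_simps)
  finally show ?case .
qed

text \<open>A diagonal entry of an even power of a symmetric matrix is a sum of squares. Only even powers are available, which is why the approximation of \<open>1/z\<close> below runs along \<open>p\<^sub>2\<^sub>m\<close>.\<close>

lemma E_even_nonneg: "0 \<le> E (m + m) i i"
proof -
  have "E (m + m) i i = (\<Sum>k\<in>{i - int m..i + int m}. E m i k * wh k * E m k i)"
    by (rule E_add) simp_all
  also have "\<dots> = (\<Sum>k\<in>{i - int m..i + int m}. wh k * (E m i k)\<^sup>2)"
    by (intro sum.cong) (simp_all add: E_sym[of m _ i] power2_eq_square)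
  also have "0 \<le> \<dots>" using wh_pos by (intro sum_nonneg mult_nonneg_nonneg) (auto simp: less_imp_le)
  finally show ?thesis .
qed

lemma AE_nonzero: "AE z in lborel. z \<noteq> (0::real)"
  by (rule AE_lborel_singleton)

text \<open>Nonnegativity of \<open>E\<close> bounds the integrals against \<open>p\<^sub>2\<^sub>m\<close> uniformly, and monotone convergence turns this into integrability against \<open>1/z\<close> with the same bound.\<close>

lemma qh_diag_over:
  shows "integrable lborel (\<lambda>z. b z (qh i z) (qh i z) / z)"
    and "c * (LINT z|lborel. b z (qh i z) (qh i z) / z) \<le> 1 / wh i"
proof -
  define f where "f m z = p (m + m) z * b z (qh i z) (qh i z)" for m z
  have p_mono: "p m z \<le> p n z" if "m \<le> n" "z \<le> 1" for m n z
    unfolding p_def using that by (intro sum_mono2) auto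
  have p_nonneg: "0 \<le> p m z" if "z \<le> 1" for m z
    using that by (simp add: p_def sum_nonneg)
  have b_supp: "b z (qh i z) (qh i z) = 0" if "z \<notin> {0..1}" for z using V_supp[OF that] by simp
  have int: "integrable lborel (f m)" for m unfolding f_def by (rule p_int)
  have bound: "integral\<^sup>L lborel (f m) \<le> 1 / (c * wh i)" for m
  proof -
    have "f m = (\<lambda>z. p (m + m) z * b z (qh i z) (qh i z))" by (simp add: f_def fun_eq_iff)
    then show ?thesis using E_even_nonneg[of m i] c_pos wh_pos[of i] by (simp add: E_def field_simps)
  qed
  have mono: "AE z in lborel. mono (\<lambda>m. f m z)"
    using b_AE
  proof eventually_elim
    case (elim z)
    show ?case
    proof (cases "z \<in> {0..1}")
      case True
      then show ?thesis using elim unfolding f_def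
        by (intro monoI mult_right_mono p_mono) auto
    qed (simp add: f_def b_supp mono_def)
  qed
  have nonneg: "AE z in lborel. 0 \<le> f m z" for m
    using b_AE
  proof eventually_elim
    case (elim z)
    show ?case
    proof (cases "z \<in> {0..1}")
      case True
      then show ?thesis using elim unfolding f_def by (intro mult_nonneg_nonneg p_nonneg) auto
    qed (simp add: f_def b_supp)
  qed
  have lim: "AE z in lborel. (\<lambda>m. f m z) \<longlonglongrightarrow> b z (qh i z) (qh i z) / z"
    using AE_nonzero
  proof eventually_elim
    case (elim z)
    show ?case
    proof (cases "z \<in> {0..1}")
      case True
      then have "\<bar>1 - z\<bar> < 1" using elim by auto
      then have "(\<lambda>k. (1 - z) ^ k) sums (1 / z)" using geometric_sums[of "1 - z"] by simp
      then have "(\<lambda>n. p n z) \<longlonglongrightarrow> 1 / z" by (simp add: sums_def p_def)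
      moreover have "strict_mono (\<lambda>m::nat. m + m)" by (simp add: strict_mono_def)
      ultimately have "(\<lambda>m. p (m + m) z) \<longlonglongrightarrow> 1 / z"
        using LIMSEQ_subseq_LIMSEQ[of "\<lambda>n. p n z" "1 / z" "\<lambda>m. m + m"] by (simp add: o_def)
      then have "(\<lambda>m. p (m + m) z * b z (qh i z) (qh i z)) \<longlonglongrightarrow> 1 / z * b z (qh i z) (qh i z)"
        by (intro tendsto_intros)
      then show ?thesis by (simp add: f_def)
    qed (simp add: f_def b_supp)
  qed
  have "incseq (\<lambda>m. integral\<^sup>L lborel (f m))"
  proof (rule incseq_SucI)
    fix m
    show "integral\<^sup>L lborel (f m) \<le> integral\<^sup>L lborel (f (Suc m))"
    proof (rule integral_mono_AE[OF int int])
      show "AE z in lborel. f m z \<le> f (Suc m) z"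
        using mono by eventually_elim (simp add: mono_def)
    qed
  qed
  then obtain L where L: "(\<lambda>m. integral\<^sup>L lborel (f m)) \<longlonglongrightarrow> L"
    using incseq_convergent[of _ "1 / (c * wh i)"] bound by blast
  have "L \<le> 1 / (c * wh i)" by (rule LIMSEQ_le_const2[OF L]) (use bound in blast)
  have meas: "(\<lambda>z. b z (qh i z) (qh i z) / z) \<in> borel_measurable lborel"
    using borel_measurable_integrable[OF b_int[OF qh_cont[of _ i] qh_cont[of _ i]]] by measurable
  show "integrable lborel (\<lambda>z. b z (qh i z) (qh i z) / z)"
    by (rule integral_monotone_convergence_nonneg(1)[OF int mono nonneg lim L meas])
  have "(LINT z|lborel. b z (qh i z) (qh i z) / z) = L"
    by (rule integral_monotone_convergence_nonneg(2)[OF int mono nonneg lim L meas])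
  then show "c * (LINT z|lborel. b z (qh i z) (qh i z) / z) \<le> 1 / wh i"
    using \<open>L \<le> _\<close> c_pos wh_pos[of i] by (simp add: field_simps)
qed

text \<open>The form given by \<open>V z\<close> is positive semidefinite, so mixed products are dominated by the diagonal ones.\<close>

lemma qh_over: "integrable lborel (\<lambda>z. b z (qh i z) (qh j z) / z)"
proof (rule Bochner_Integration.integrable_bound)
  show "integrable lborel (\<lambda>z. (b z (qh i z) (qh i z) / z + b z (qh j z) (qh j z) / z) / 2)"
    using qh_diag_over(1) by simp
  show "(\<lambda>z. b z (qh i z) (qh j z) / z) \<in> borel_measurable lborel"
    using borel_measurable_integrable[OF b_int[OF qh_cont[of _ i] qh_cont[of _ j]]] by measurable
  show "AE z in lborel. norm (b z (qh i z) (qh j z) / z)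
      \<le> norm ((b z (qh i z) (qh i z) / z + b z (qh j z) (qh j z) / z) / 2)"
    using b_AE
  proof eventually_elim
    case (elim z)
    let ?u = "qh i z" and ?v = "qh j z"
    have "0 \<le> b z (?u + r *\<^sub>R ?v) (?u + r *\<^sub>R ?v)" for r using elim by blast
    then have "0 \<le> b z ?u ?u + 2 * r * b z ?u ?v + r * r * b z ?v ?v" for r
      using elim by (simp add: b_linear algebra_simps)
    from this[of 1] this[of "-1"] have "2 * \<bar>b z ?u ?v\<bar> \<le> \<bar>b z ?u ?u + b z ?v ?v\<bar>" by linarith
    then have "\<bar>b z ?u ?v\<bar> / \<bar>z\<bar> \<le> (\<bar>b z ?u ?u + b z ?v ?v\<bar> / 2) / \<bar>z\<bar>"
      by (intro divide_right_mono) auto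
    then show ?case by (simp add: add_divide_distrib[symmetric] abs_divide)
  qed
qed

text \<open>The limit of \<open>E n\<close>; it represents the projection onto the kernel of \<open>L\<close>, that is, a possible mass at \<open>0\<close> of the spectral matrix of \<open>U L\<close>.\<close>

definition D :: "int \<Rightarrow> int \<Rightarrow> real" where
  "D i j = (if i = j then 1 / wh j else 0) - c * (LINT z|lborel. b z (qh i z) (qh j z) / z)"

lemma D_sym: "D i j = D j i"
proof -
  have "(LINT z|lborel. b z (qh i z) (qh j z) / z) = (LINT z|lborel. b z (qh j z) (qh i z) / z)"
  proof (rule integral_cong_AE)
    show "AE z in lborel. b z (qh i z) (qh j z) / z = b z (qh j z) (qh i z) / z"
      using b_AE by eventually_elim simp
  qed (use qh_over in \<open>blast intro: borel_measurable_integrable\<close>)+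
  then show ?thesis by (auto simp: D_def)
qed

text \<open>\<open>L\<close> annihilates \<open>D\<close>: applying it to the \<open>qh\<close> produces a factor \<open>z\<close> that cancels the denominator, and the remaining integral is the adjointness relation between \<open>L\<close> and \<open>U\<close>.\<close>

lemma D_rec: "x i * D i j + y i * D (i - 1) j = 0"
proof -
  let ?J = "\<lambda>i. LINT z|lborel. b z (qh i z) (qh j z) / z"
  have "x i * ?J i + y i * ?J (i - 1)
      = (LINT z|lborel. x i * (b z (qh i z) (qh j z) / z) + y i * (b z (qh (i - 1) z) (qh j z) / z))"
    using qh_over by (simp del: times_divide_eq_right)
  also have "\<dots> = (LINT z|lborel. b z (q i z) (qh j z))"
  proof (rule integral_cong_AE)
    show "AE z in lborel. x i * (b z (qh i z) (qh j z) / z) + y i * (b z (qh (i - 1) z) (qh j z) / z)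
        = b z (q i z) (qh j z)"
      using AE_nonzero
    proof eventually_elim
      case (elim z)
      have "z * b z (q i z) (qh j z) = x i * b z (qh i z) (qh j z) + y i * b z (qh (i - 1) z) (qh j z)"
        by (metis qh_lower b_linear(1,3))
      then show ?case using elim by (simp add: field_simps)
    qed
    show "(\<lambda>z. x i * (b z (qh i z) (qh j z) / z) + y i * (b z (qh (i - 1) z) (qh j z) / z)) \<in> borel_measurable lborel"
      using qh_over by (intro borel_measurable_integrable) (simp del: times_divide_eq_right)
  qed (rule borel_measurable_integrable[OF b_int[OF q_cont qh_cont]])
  also have "c * \<dots> = (if j = i then x i else if j = i - 1 then y i else 0) / wh j"
    using c_pos by (simp add: q_qh_inner)
  finally have "c * (x i * ?J i + y i * ?J (i - 1)) = \<dots>" by simp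
  then show ?thesis by (simp add: D_def algebra_simps split: if_splits)
qed

text \<open>The difference of the two sides is the integral of a nonnegative quadratic form divided by \<open>z\<close>.\<close>

lemma D_form_le: "(\<Sum>m<N. \<Sum>n<N. a m * a n * D (int m) (int n)) \<le> (\<Sum>n<N. (a n)\<^sup>2 / wh (int n))"
proof -
  have lin: "b z (\<Sum>m<N. a m *\<^sub>R qh (int m) z) (\<Sum>n<N. a n *\<^sub>R qh (int n) z)
     = (\<Sum>m<N. \<Sum>n<N. a m * a n * b z (qh (int m) z) (qh (int n) z))" for z
  proof -
    have "V z *v (\<Sum>n<N. a n *\<^sub>R qh (int n) z) = (\<Sum>n<N. a n *\<^sub>R (V z *v qh (int n) z))"
      by (induction N) (simp_all add: matrix_vector_right_distrib matrix_vector_mult_scaleR)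
    then have "b z u (\<Sum>n<N. a n *\<^sub>R qh (int n) z) = (\<Sum>n<N. a n * b z u (qh (int n) z))" for u
      by (simp add: inner_sum_right)
    then show ?thesis
      by (simp add: inner_sum_left sum_distrib_left mult.assoc) (subst sum.swap, simp add: mult.left_commute)
  qed
  have "0 \<le> (LINT z|lborel. b z (\<Sum>m<N. a m *\<^sub>R qh (int m) z) (\<Sum>n<N. a n *\<^sub>R qh (int n) z) / z)"
  proof (rule integral_nonneg_AE)
    show "AE z in lborel. 0 \<le> b z (\<Sum>m<N. a m *\<^sub>R qh (int m) z) (\<Sum>n<N. a n *\<^sub>R qh (int n) z) / z"
      using b_AE
    proof eventually_elim
      case (elim z)
      then show ?case by (cases "z \<in> {0..1}") (auto simp: V_supp)
    qed
  qed
  also have "\<dots> = (LINT z|lborel. (\<Sum>m<N. \<Sum>n<N. a m * a n * (b z (qh (int m) z) (qh (int n) z) / z)))"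
    by (simp add: lin sum_divide_distrib)
  also have "\<dots> = (\<Sum>m<N. \<Sum>n<N. a m * a n * (LINT z|lborel. b z (qh (int m) z) (qh (int n) z) / z))"
    using qh_over by (simp del: times_divide_eq_right)
  finally have "0 \<le> c * \<dots>" using c_pos by simp
  moreover have "(\<Sum>m<N. \<Sum>n<N. a m * a n * D (int m) (int n))
     = (\<Sum>m<N. \<Sum>n<N. if m = n then a m * a n / wh (int n) else 0)
       - c * (\<Sum>m<N. \<Sum>n<N. a m * a n * (LINT z|lborel. b z (qh (int m) z) (qh (int n) z) / z))"
    unfolding sum_distrib_left sum_subtractf[symmetric]
    by (intro sum.cong) (auto simp: D_def algebra_simps)
  moreover have "(\<Sum>m<N. \<Sum>n<N. if m = n then a m * a n / wh (int n) else 0) = (\<Sum>n<N. (a n)\<^sup>2 / wh (int n))"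
    by (intro sum.cong) (auto simp: power2_eq_square)
  ultimately show ?thesis by linarith
qed

text \<open>By the recurrence and symmetry \<open>D\<close> is \<open>D\<^sub>0\<^sub>0 f\<^sub>i f\<^sub>j\<close> with \<open>L f = 0\<close>. Testing the upper bound for the form on \<open>f\<^sub>n wh\<^sub>n\<close>, \<open>n < N\<close>, gives \<open>D\<^sub>0\<^sub>0 S\<^sup>2 \<le> S\<close> for the partial sum \<open>S\<close> of the squared norm of \<open>f\<close>, which is unbounded.\<close>

lemma D_eq_0: "D i j = 0"
proof -
  define f where "f n = (\<Prod>k<n. - (y (int k + 1) / x (int k + 1)))" for n
  define g where "g n = (f n)\<^sup>2 * wh (int n)" for n
  have shift: "D (int n) j = f n * D 0 j" for n j
  proof (induction n)
    case (Suc n)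
    have "x (int n + 1) * D (int n + 1) j = - (y (int n + 1) * D (int n) j)"
      using D_rec[of "int n + 1" j] by simp
    then have "D (int n + 1) j = - (y (int n + 1) * D (int n) j) / x (int n + 1)"
      by (metis nonzero_mult_div_cancel_left nz(1))
    then show ?case using Suc by (simp add: f_def add.commute)
  qed (simp add: f_def)
  have D_ff: "D (int m) (int n) = f m * f n * D 0 0" for m n
    using shift[of m "int n"] shift[of n 0] D_sym[of 0 "int n"] by simp
  have le: "D 0 0 * (\<Sum>n<N. g n)\<^sup>2 \<le> (\<Sum>n<N. g n)" for N
  proof -
    have "(\<Sum>m<N. \<Sum>n<N. (f m * wh (int m)) * (f n * wh (int n)) * D (int m) (int n))
        = D 0 0 * (\<Sum>n<N. g n)\<^sup>2"
      by (simp add: D_ff g_def power2_eq_square sum_product sum_distrib_left mult_ac)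
    moreover have "(\<Sum>n<N. (f n * wh (int n))\<^sup>2 / wh (int n)) = (\<Sum>n<N. g n)"
      using wh_pos by (intro sum.cong) (auto simp: g_def power2_eq_square less_imp_neq[symmetric])
    ultimately show ?thesis
      using D_form_le[of "\<lambda>n. f n * wh (int n)" N] by simp
  qed
  have g_nonneg: "0 \<le> g n" for n using wh_pos[of "int n"] by (simp add: g_def)
  have "D 0 0 \<le> 0"
  proof (rule ccontr)
    assume "\<not> D 0 0 \<le> 0"
    then have "(\<Sum>n<N. g n) \<le> 1 / D 0 0" for N
    proof (cases "(\<Sum>n<N. g n) = 0")
      case False
      then have "0 < (\<Sum>n<N. g n)" using sum_nonneg[of "{..<N}" g] g_nonneg by auto
      then have "D 0 0 * (\<Sum>n<N. g n) \<le> 1"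
        using le[of N] by (simp add: power2_eq_square mult.assoc[symmetric])
      then show ?thesis using \<open>\<not> D 0 0 \<le> 0\<close> by (simp add: field_simps)
    qed simp
    then have "summable g" by (intro summableI_nonneg_bounded g_nonneg)
    moreover have "g = (\<lambda>n. (\<Prod>k<n. (y (int k + 1) / x (int k + 1))\<^sup>2) * wh (int n))"
      by (simp add: g_def f_def fun_eq_iff prod_power_distrib power2_eq_square prod.distrib[symmetric])
    ultimately show False using kernel_free by simp
  qed
  moreover have "0 \<le> D 0 0" using qh_diag_over(2)[of 0] by (simp add: D_def)
  ultimately have D00: "D 0 0 = 0" by simp
  have col: "D i j = 0" if "D 0 j = 0" for i j
  proof (induction i rule: int_step_induct)
    case neg
    show ?case using D_rec[of 0 j] that by simp
  next
    case (step n)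
    then show ?case using D_rec[of "n + 1" j] by simp
  next
    case (down n)
    then show ?case using D_rec[of n j] by simp
  qed (rule that)
  have "D 0 j = 0" using col[of 0 j] D00 by (simp add: D_sym[of 0 j])
  then show ?thesis by (rule col)
qed

lemma qh_orth: "c * (LINT z|lborel. b z (qh i z) (qh j z) / z) = (if i = j then 1 / wh j else 0)"
  using D_eq_0[of i j] by (simp add: D_def)

text \<open>These are the rows of \<open>T\<^sub>0\<close>, so that \<open>Vh\<close> is \<open>c T\<^sub>0 (V/z) T\<^sub>0\<^sup>T\<close>.\<close>

definition T_row :: "2 \<Rightarrow> real \<Rightarrow> real^2" where "T_row \<eta> = (if \<eta> = 1 then qh 0 else qh (-1))"

definition Vh :: "real \<Rightarrow> real^2^2" where
  "Vh z = (\<chi> \<eta> \<xi>. c * (b z (T_row \<eta> z) (T_row \<xi> z) / z))"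

lemma Vh_supp: "z \<notin> {0..1} \<Longrightarrow> Vh z = 0"
  by (simp add: Vh_def V_supp vec_eq_iff)

lemma Vh_int: "integrable lborel Vh"
proof -
  have "integrable lborel (\<lambda>z. c * (b z (T_row \<eta> z) (T_row \<xi> z) / z))" for \<eta> \<xi>
    using qh_over by (simp add: T_row_def del: times_divide_eq_right)
  then have "integrable lborel (\<lambda>z. \<Sum>\<eta>\<in>UNIV. \<Sum>\<xi>\<in>UNIV.
      (c * (b z (T_row \<eta> z) (T_row \<xi> z) / z)) *\<^sub>R (axis \<eta> (axis \<xi> 1) :: real^2^2))"
    by (intro Bochner_Integration.integrable_sum integrable_scaleR_left)
  also have "(\<lambda>z. \<Sum>\<eta>\<in>UNIV. \<Sum>\<xi>\<in>UNIV.
      (c * (b z (T_row \<eta> z) (T_row \<xi> z) / z)) *\<^sub>R (axis \<eta> (axis \<xi> 1) :: real^2^2)) = Vh"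
    by (simp add: fun_eq_iff vec_eq_iff Vh_def sum_2 forall_2 axis_def)
  finally show ?thesis .
qed

lemma Vh_form: "u \<bullet> (Vh z *v v) = c * (b z (\<Sum>\<eta>\<in>UNIV. u $ \<eta> *\<^sub>R T_row \<eta> z) (\<Sum>\<xi>\<in>UNIV. v $ \<xi> *\<^sub>R T_row \<xi> z) / z)"
  unfolding mat2_quadform[of u "Vh z"] sum_2 b_linear
  by (simp add: Vh_def add_divide_distrib algebra_simps)

lemma Vh_psd: "AE z in lborel. psd (Vh z)"
  using b_AE
proof eventually_elim
  case (elim z)
  have "0 \<le> u \<bullet> (Vh z *v u)" for u
  proof (cases "z \<in> {0..1}")
    case True
    then show ?thesis unfolding Vh_form using elim c_pos by (intro mult_nonneg_nonneg divide_nonneg_nonneg) auto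
  qed (simp add: Vh_supp)
  moreover have "transpose (Vh z) = Vh z" using elim by (simp add: Vh_def transpose_def vec_eq_iff)
  ultimately show ?case by (simp add: psd_def)
qed

lemma spectral_matrix_UL:
  assumes init: "\<And>z. q 0 z = axis 1 1" "\<And>z. q (-1) z = axis 2 1"
  shows "spectral_matrix UL (\<lambda>A. LINT z:A|lborel. Vh z)"
  unfolding spectral_matrix_def
proof (intro conjI)
  show mm: "matrix_measure (\<lambda>A. LINT z:A|lborel. Vh z)"
    by (rule matrix_measure_density[OF Vh_int Vh_psd])
  show "(LINT z:- {-1..1}|lborel. Vh z) = 0"
  proof -
    have "indicator (- {-1..1}) z *\<^sub>R Vh z = 0" for z
      by (cases "z \<in> {0..1}") (auto simp: Vh_supp)
    then show ?thesis unfolding set_lebesgue_integral_def by (simp only: integral_zero)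
  qed
  obtain Q where Q: "spectral_polys UL Q"
    using spectral_polys_exist[of UL] by auto
  have Q0: "Q 1 0 = 1" "Q 1 (-1) = 0" "Q 2 0 = 0" "Q 2 (-1) = 1"
    using Q by (simp_all add: spectral_polys_def)
  \<comment> \<open>Both sides solve the recurrence of the swapped product and agree at the indices 0 and -1.\<close>
  have comb: "(\<Sum>\<eta>\<in>UNIV. poly (Q \<eta> n) z *\<^sub>R T_row \<eta> z) = qh n z" for n z
  proof -
    have "(\<Sum>\<eta>\<in>UNIV. poly (Q \<eta> n) z *\<^sub>R T_row \<eta> z) $ k = qh n z $ k" for k
    proof (rule three_term_unique[of UL z "\<lambda>n. (\<Sum>\<eta>\<in>UNIV. poly (Q \<eta> n) z *\<^sub>R T_row \<eta> z) $ k" "\<lambda>n. qh n z $ k"])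
      fix n
      show "z * (\<Sum>\<eta>\<in>UNIV. poly (Q \<eta> n) z *\<^sub>R T_row \<eta> z) $ k
        = UL n (n + 1) * (\<Sum>\<eta>\<in>UNIV. poly (Q \<eta> (n + 1)) z *\<^sub>R T_row \<eta> z) $ k
        + UL n n * (\<Sum>\<eta>\<in>UNIV. poly (Q \<eta> n) z *\<^sub>R T_row \<eta> z) $ k
        + UL n (n - 1) * (\<Sum>\<eta>\<in>UNIV. poly (Q \<eta> (n - 1)) z *\<^sub>R T_row \<eta> z) $ k"
      proof -
        have "z * (\<Sum>\<eta>\<in>UNIV. poly (Q \<eta> n) z *\<^sub>R T_row \<eta> z) $ k
          = (z * poly (Q 1 n) z) * T_row 1 z $ k + (z * poly (Q 2 n) z) * T_row 2 z $ k"
          by (simp add: sum_2 algebra_simps)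
        also have "\<dots> = (UL n (n + 1) * poly (Q 1 (n + 1)) z + UL n n * poly (Q 1 n) z
            + UL n (n - 1) * poly (Q 1 (n - 1)) z) * T_row 1 z $ k
          + (UL n (n + 1) * poly (Q 2 (n + 1)) z + UL n n * poly (Q 2 n) z
            + UL n (n - 1) * poly (Q 2 (n - 1)) z) * T_row 2 z $ k"
          unfolding spectral_polys_poly[OF Q, of z 1 n] spectral_polys_poly[OF Q, of z 2 n] by (rule refl)
        finally show ?thesis by (simp add: sum_2 algebra_simps del: UL_simps)
      qed
      show "z * qh n z $ k = UL n (n + 1) * qh (n + 1) z $ k + UL n n * qh n z $ k + UL n (n - 1) * qh (n - 1) z $ k"
        using arg_cong[OF qh_rec[of z n], of "\<lambda>v. v $ k"] by (simp del: UL_simps)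
    qed (simp_all add: sum_2 Q0 T_row_def)
    then show ?thesis by (simp add: vec_eq_iff)
  qed
  have "(\<Sum>\<eta>\<in>UNIV. \<Sum>\<xi>\<in>UNIV.
          entry_integral (\<lambda>A. LINT z:A|lborel. Vh z) \<eta> \<xi> (\<lambda>z. poly (Q \<eta> i) z * poly (Q \<xi> j) z))
      = (if i = j then 1 / potential UL j else 0)" for i j
  proof -
    have int: "integrable lborel (\<lambda>z. (poly (Q \<eta> i) z * poly (Q \<xi> j) z) * Vh z $ k $ l)" for \<eta> \<xi> k l
      by (rule integrable_cont_mult[OF integrable_bounded_linear[OF bounded_linear_entry Vh_int]])
        (auto simp: Vh_supp intro!: continuous_intros)
    have "entry_integral (\<lambda>A. LINT z:A|lborel. Vh z) \<eta> \<xi> (\<lambda>z. poly (Q \<eta> i) z * poly (Q \<xi> j) z)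
       = (LINT z|lborel. (poly (Q \<eta> i) z * poly (Q \<xi> j) z) * Vh z $ \<eta> $ \<xi>)" for \<eta> \<xi>
      by (rule entry_integral_density[OF refl Vh_int Vh_psd _ int])
        (intro borel_measurable_continuous_onI continuous_intros)
    then have "(\<Sum>\<eta>\<in>UNIV. \<Sum>\<xi>\<in>UNIV.
          entry_integral (\<lambda>A. LINT z:A|lborel. Vh z) \<eta> \<xi> (\<lambda>z. poly (Q \<eta> i) z * poly (Q \<xi> j) z))
      = (LINT z|lborel. (\<Sum>\<eta>\<in>UNIV. \<Sum>\<xi>\<in>UNIV. (poly (Q \<eta> i) z * poly (Q \<xi> j) z) * Vh z $ \<eta> $ \<xi>))"
      using int by simp
    also have "(\<lambda>z. \<Sum>\<eta>\<in>UNIV. \<Sum>\<xi>\<in>UNIV. (poly (Q \<eta> i) z * poly (Q \<xi> j) z) * Vh z $ \<eta> $ \<xi>)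
      = (\<lambda>z. c * (b z (qh i z) (qh j z) / z))"
    proof
      fix z
      have "(\<Sum>\<eta>\<in>UNIV. \<Sum>\<xi>\<in>UNIV. (poly (Q \<eta> i) z * poly (Q \<xi> j) z) * Vh z $ \<eta> $ \<xi>)
        = (\<chi> \<eta>. poly (Q \<eta> i) z) \<bullet> (Vh z *v (\<chi> \<xi>. poly (Q \<xi> j) z))"
        by (simp add: mat2_quadform mult_ac)
      also have "\<dots> = c * (b z (qh i z) (qh j z) / z)"
        unfolding Vh_form by (simp add: comb)
      finally show "(\<Sum>\<eta>\<in>UNIV. \<Sum>\<xi>\<in>UNIV. (poly (Q \<eta> i) z * poly (Q \<xi> j) z) * Vh z $ \<eta> $ \<xi>) = \<dots>" .
    qed
    finally show ?thesis using qh_orth[of i j] by (simp add: wh_def del: times_divide_eq_right)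
  qed
  then show "\<exists>Q. spectral_polys UL Q \<and> (\<forall>i j. (\<Sum>\<eta>\<in>UNIV. \<Sum>\<xi>\<in>UNIV.
          entry_integral (\<lambda>A. LINT z:A|lborel. Vh z) \<eta> \<xi> (\<lambda>z. poly (Q \<eta> i) z * poly (Q \<xi> j) z))
      = (if i = j then 1 / potential UL j else 0))"
    using Q by blast
qed

end

section \<open>The parameters of the associated Jacobi polynomials\<close>

text \<open>No integer translate of \<open>(n, n + 1)\<close> contains \<open>0\<close>.\<close>

lemma same_sign_from_gap:
  fixes a b :: real and t :: real and k n :: int
  assumes "n < t + a" "t + a < n + 1" "n < t + b" "t + b < n + 1"
  shows "0 < (k + t + a) * (k + t + b)"
proof (cases "0 \<le> k + n")
  case True
  then have "0 \<le> real_of_int k + real_of_int n" by (metis of_int_0_le_iff of_int_add)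
  then show ?thesis using assms by (intro mult_pos_pos) linarith+
next
  case False
  then have "k + n + 1 \<le> 0" by simp
  then have "real_of_int k + real_of_int n + 1 \<le> 0" by linarith
  then show ?thesis using assms by (intro mult_neg_neg) linarith+
qed

text \<open>In each of the four parameter regimes, \<open>t\<close> and \<open>t + \<alpha> + \<beta>\<close> lie strictly between the same two consecutive integers, and so do \<open>t + \<alpha>\<close> and \<open>t + \<beta> + 1\<close>. Numerator and denominator of each coefficient of the factors are then built from two numbers of the same sign.\<close>

lemma admissible_signs:
  assumes "admissible \<alpha> \<beta> t"
  shows "0 < (real_of_int k + t) * (k + t + (\<alpha> + \<beta>))"
    and "0 < (k + t + \<alpha>) * (k + t + (\<beta> + 1))"
proof -
  have 1: "0 < \<alpha>" "\<alpha> < 1" "-1 < \<beta>" "\<beta> < 0" using assms by (auto simp: admissible_def)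
  have "\<exists>(m::int) (n::int). m < t \<and> t < m + 1 \<and> m < t + (\<alpha> + \<beta>) \<and> t + (\<alpha> + \<beta>) < m + 1
        \<and> n < t + \<alpha> \<and> t + \<alpha> < n + 1 \<and> n < t + (\<beta> + 1) \<and> t + (\<beta> + 1) < n + 1"
    (is "\<exists>m n. ?P m n")
  proof -
    consider
        (A1) n :: int where "\<beta> - \<alpha> + 1 > 0" "\<alpha> > -\<beta>" "n < t" "t < n - \<beta>"
      | (A1') n :: int where "\<beta> - \<alpha> + 1 > 0" "\<alpha> > -\<beta>" "n - \<alpha> < t" "t < n - \<alpha> - \<beta>"
      | (A2) n :: int where "\<beta> - \<alpha> + 1 > 0" "\<alpha> < -\<beta>" "n - \<alpha> < t" "t < n"
      | (A2') n :: int where "\<beta> - \<alpha> + 1 > 0" "\<alpha> < -\<beta>" "n - \<alpha> - \<beta> < t" "t < n - \<beta>"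
      | (B1) n :: int where "\<beta> - \<alpha> + 1 < 0" "\<alpha> > -\<beta>" "n < t" "t < n - \<alpha> + 1"
      | (B1') n :: int where "\<beta> - \<alpha> + 1 < 0" "\<alpha> > -\<beta>" "n - \<beta> < t" "t < n - \<alpha> - \<beta> + 1"
      | (B2) n :: int where "\<beta> - \<alpha> + 1 < 0" "\<alpha> < -\<beta>" "n - \<beta> - 1 < t" "t < n"
      | (B2') n :: int where "\<beta> - \<alpha> + 1 < 0" "\<alpha> < -\<beta>" "n - \<alpha> - \<beta> < t" "t < n - \<alpha> + 1"
      using assms unfolding admissible_def by fastforce
    then show ?thesis
    proof cases
      case (A1 n)
      with 1 have "?P n n" by auto
      then show ?thesis by blast
    next
      case (A1' n)
      with 1 have "?P (n - 1) n" by auto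
      then show ?thesis by blast
    next
      case (A2 n)
      with 1 have "?P (n - 1) n" by auto
      then show ?thesis by blast
    next
      case (A2' n)
      with 1 have "?P n n" by auto
      then show ?thesis by blast
    next
      case (B1 n)
      with 1 have "?P n n" by auto
      then show ?thesis by blast
    next
      case (B1' n)
      with 1 have "?P n (n + 1)" by auto
      then show ?thesis by blast
    next
      case (B2 n)
      with 1 have "?P (n - 1) n" by auto
      then show ?thesis by blast
    next
      case (B2' n)
      with 1 have "?P n n" by auto
      then show ?thesis by blast
    qed
  qed
  then obtain m n :: int where "?P m n" by blast
  then show "0 < (real_of_int k + t) * (k + t + (\<alpha> + \<beta>))" "0 < (k + t + \<alpha>) * (k + t + (\<beta> + 1))"
    using same_sign_from_gap[of m t 0 "\<alpha> + \<beta>" k] same_sign_from_gap[of n t \<alpha> "\<beta> + 1" k] by auto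
qed

lemma same_sign_quotient:
  fixes a b :: real
  assumes "0 < a * b" shows "0 < a / (a + b)" and "0 < b / (a + b)" and "a + b \<noteq> 0"
  using assms by (auto simp: zero_less_mult_iff zero_less_divide_iff)

context
  fixes \<alpha> \<beta> t :: real
  assumes adm: "admissible \<alpha> \<beta> t"
begin

lemma seq_pos: "0 < x_seq \<alpha> \<beta> t n" "0 < y_seq \<alpha> \<beta> t n" "0 < s_seq \<alpha> \<beta> t n" "0 < t_seq \<alpha> \<beta> t n"
  using same_sign_quotient(1,2)[OF admissible_signs(1)[OF adm, of n]]
    same_sign_quotient(1,2)[OF admissible_signs(2)[OF adm, of n]]
  by (simp_all add: x_seq_def y_seq_def s_seq_def t_seq_def algebra_simps)

lemma denominators_nz: "2 * real_of_int n + 2 * t + \<alpha> + \<beta> \<noteq> 0" "2 * real_of_int n + 2 * t + \<alpha> + \<beta> + 1 \<noteq> 0"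
  using same_sign_quotient(3)[OF admissible_signs(1)[OF adm, of n]]
    same_sign_quotient(3)[OF admissible_signs(2)[OF adm, of n]]
  by (simp_all add: algebra_simps)

lemma seq_sums: "x_seq \<alpha> \<beta> t n + y_seq \<alpha> \<beta> t n = 1" "s_seq \<alpha> \<beta> t n + t_seq \<alpha> \<beta> t n = 1"
  using denominators_nz[of n]
  by (simp_all add: x_seq_def y_seq_def s_seq_def t_seq_def add_divide_distrib[symmetric])

interpretation LU_factors "x_seq \<alpha> \<beta> t" "y_seq \<alpha> \<beta> t" "s_seq \<alpha> \<beta> t" "t_seq \<alpha> \<beta> t"
  by unfold_locales (rule seq_pos)+

lemma P_mat_eq_LU: "P_mat \<alpha> \<beta> t = LU"
proof (intro ext)
  fix i j :: int
  have "p_coeff \<alpha> \<beta> t i = x_seq \<alpha> \<beta> t i * s_seq \<alpha> \<beta> t (i + 1)"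
    by (simp add: p_coeff_def x_seq_def s_seq_def algebra_simps)
  moreover have "q_coeff \<alpha> \<beta> t i = y_seq \<alpha> \<beta> t i * t_seq \<alpha> \<beta> t i"
    by (simp add: q_coeff_def y_seq_def t_seq_def algebra_simps)
  moreover have "r_coeff \<alpha> \<beta> t i = x_seq \<alpha> \<beta> t i * t_seq \<alpha> \<beta> t (i + 1) + y_seq \<alpha> \<beta> t i * s_seq \<alpha> \<beta> t i"
    by (simp add: r_coeff_def x_seq_def y_seq_def t_seq_def s_seq_def algebra_simps)
  ultimately show "P_mat \<alpha> \<beta> t i j = LU i j" by (simp add: P_mat_def LU_def)
qed

lemma Phat_mat_eq_UL: "Phat_mat \<alpha> \<beta> t = UL"
proof (intro ext)
  fix i j :: int
  have "Phat_mat \<alpha> \<beta> t i j = (\<Sum>\<^sub>\<infinity>k\<in>{i, i + 1}. PU_mat \<alpha> \<beta> t i k * PL_mat \<alpha> \<beta> t k j)"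
    unfolding Phat_mat_def bi_mult_def by (rule infsum_cong_neutral) (auto simp: PU_mat_def)
  then show "Phat_mat \<alpha> \<beta> t i j = UL i j"
    by (auto simp: PU_mat_def PL_mat_def UL_def)
qed

lemma UL_coefficients:
  "UL n (n + 1) = p_coeff (\<alpha> - 1) \<beta> t (n + 1)"
  "UL n n = r_coeff (\<alpha> - 1) \<beta> t (n + 1)"
  "UL n (n - 1) = q_coeff (\<alpha> - 1) \<beta> t (n + 1)"
proof -
  show "UL n (n + 1) = p_coeff (\<alpha> - 1) \<beta> t (n + 1)"
    unfolding UL_simps by (simp add: p_coeff_def x_seq_def s_seq_def algebra_simps)
  show "UL n (n - 1) = q_coeff (\<alpha> - 1) \<beta> t (n + 1)"
    unfolding UL_simps by (simp add: q_coeff_def y_seq_def t_seq_def algebra_simps)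
  define m where "m = n + t"
  define d where "d = 2 * m + \<alpha> + \<beta>"
  have nz: "d + 1 \<noteq> 0" "d + 2 \<noteq> 0" "d + 3 \<noteq> 0"
    using denominators_nz[of n] denominators_nz[of "n + 1"] by (simp_all add: d_def m_def algebra_simps)
  have "UL n n = (m + 1) / (d + 2) * ((m + \<beta> + 1) / (d + 1)) + (m + 1 + \<alpha> + \<beta>) / (d + 2) * ((m + 1 + \<alpha>) / (d + 3))"
    by (simp add: x_seq_def y_seq_def s_seq_def t_seq_def d_def m_def algebra_simps)
  also have "\<dots> = (m + 2 + \<beta>) * (m + 2) / ((d + 2) * (d + 3)) + (m + \<alpha>) * (m + \<alpha> + \<beta>) / ((d + 1) * (d + 2))"
  proof -
    have "(m + 1) * (m + \<beta> + 1) * (d + 3) + (m + 1 + \<alpha> + \<beta>) * (m + 1 + \<alpha>) * (d + 1)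
      = (m + 2 + \<beta>) * (m + 2) * (d + 1) + (m + \<alpha>) * (m + \<alpha> + \<beta>) * (d + 3)"
      unfolding d_def by algebra
    moreover have "A / (d2 * d1) + B / (d2 * d3) = F / (d2 * d3) + G / (d1 * d2)"
      if "A * d3 + B * d1 = F * d1 + G * d3" "d1 \<noteq> 0" "d2 \<noteq> 0" "d3 \<noteq> 0" for A B F G d1 d2 d3 :: real
    proof -
      have "(A * d3 + B * d1) / (d1 * d2 * d3) = (F * d1 + G * d3) / (d1 * d2 * d3)"
        using that(1) by simp
      then show ?thesis using that(2-) by (simp add: add_divide_distrib mult_ac)
    qed
    ultimately show ?thesis unfolding times_divide_times_eq using nz by blast
  qed
  also have "\<dots> = r_coeff (\<alpha> - 1) \<beta> t (n + 1)"
    by (simp add: r_coeff_def d_def m_def algebra_simps)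
  finally show "UL n n = r_coeff (\<alpha> - 1) \<beta> t (n + 1)" .
qed

lemma UL_stochastic: "stochastic UL"
  unfolding stochastic_def
proof (intro conjI allI)
  show "0 \<le> UL i j" for i j
    using seq_pos by (auto simp: UL_def less_imp_le intro!: add_nonneg_nonneg mult_nonneg_nonneg)
  fix i
  have "(\<Sum>j\<in>{i - 1, i, i + 1}. UL i j) = 1"
  proof -
    have "(\<Sum>j\<in>{i - 1, i, i + 1}. UL i j) = UL i (i - 1) + (UL i i + UL i (i + 1))"
      by (simp del: UL_simps)
    also have "\<dots> = t_seq \<alpha> \<beta> t (i + 1) * (x_seq \<alpha> \<beta> t i + y_seq \<alpha> \<beta> t i)
      + s_seq \<alpha> \<beta> t (i + 1) * (x_seq \<alpha> \<beta> t (i + 1) + y_seq \<alpha> \<beta> t (i + 1))"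
      unfolding UL_simps by (simp only: algebra_simps)
    finally show ?thesis using seq_sums(2)[of "i + 1"] by (simp add: seq_sums(1) add.commute)
  qed
  then have "(UL i has_sum 1) {i - 1, i, i + 1}" using has_sum_finite[of "{i - 1, i, i + 1}" "UL i"] by simp
  moreover have "(UL i has_sum 1) {i - 1, i, i + 1} \<longleftrightarrow> (UL i has_sum 1) UNIV"
    by (rule has_sum_cong_neutral) (auto simp: UL_def)
  ultimately show "(UL i has_sum 1) UNIV" by simp
qed

text \<open>With \<open>m = n + 1 + t\<close> the ratio of consecutive terms is a rational function of \<open>m\<close> equal to \<open>1 + (2\<alpha> - 1)/m\<close> up to order \<open>m\<^sup>-\<^sup>2\<close>. Since \<open>\<alpha> > 0\<close> it eventually exceeds \<open>m/(m + 1)\<close>, so the terms are eventually bounded below by a multiple of \<open>1/m\<close>.\<close>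

lemma kernel_diverges:
  "\<not> summable (\<lambda>n. (\<Prod>k<n. (y_seq \<alpha> \<beta> t (int k + 1) / x_seq \<alpha> \<beta> t (int k + 1))\<^sup>2) * wh (int n))"
proof
  define a where "a n = (\<Prod>k<n. (y_seq \<alpha> \<beta> t (int k + 1) / x_seq \<alpha> \<beta> t (int k + 1))\<^sup>2) * wh (int n)" for n
  assume "summable (\<lambda>n. (\<Prod>k<n. (y_seq \<alpha> \<beta> t (int k + 1) / x_seq \<alpha> \<beta> t (int k + 1))\<^sup>2) * wh (int n))"
  then have summ: "summable a" by (simp add: a_def[abs_def])
  have ab: "0 < \<alpha>" "\<alpha> < 1" "-1 < \<beta>" "\<beta> < 0" using adm by (auto simp: admissible_def)
  have a_pos: "0 < a n" for n
    using seq_pos wh_pos unfolding a_def by (intro mult_pos_pos prod_pos) (simp_all add: less_imp_neq[symmetric])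
  define \<sigma> where "\<sigma> = \<alpha> + \<beta>"
  \<comment> \<open>In the comparison with \<open>m/(m + 1)\<close>, clearing denominators leaves \<open>4 \<alpha> m\<^sup>2 + K m + C \<ge> 0\<close>, and \<open>B\<close> is large enough for that.\<close>
  define K where "K = (\<alpha> + \<sigma>) * (2 + \<sigma>) + 2 * \<alpha> * \<sigma> - (\<beta> + 1) * \<sigma>"
  define C where "C = \<alpha> * \<sigma> * (2 + \<sigma>)"
  define B where "B = max 1 ((\<bar>K\<bar> + \<bar>C\<bar>) / (4 * \<alpha>))"
  have ratio: "m \<le> (m + 1) * ((m + \<alpha>) * (m + \<sigma>) * (2 * m + \<sigma> + 2) / ((m + \<beta> + 1) * (2 * m + \<sigma>) * (m + 1)))"
    if m: "B \<le> m" for m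
  proof -
    have m1: "1 \<le> m" "(\<bar>K\<bar> + \<bar>C\<bar>) / (4 * \<alpha>) \<le> m" using m by (simp_all add: B_def)
    have pos: "0 < m + \<beta> + 1" "0 < 2 * m + \<sigma>" using m1 ab by (simp_all add: \<sigma>_def)
    have "(\<bar>K\<bar> + \<bar>C\<bar>) \<le> 4 * \<alpha> * m" using m1(2) ab by (simp add: field_simps)
    then have "(\<bar>K\<bar> + \<bar>C\<bar>) * m \<le> 4 * \<alpha> * m * m" using m1(1) by (intro mult_right_mono) auto
    moreover have "\<bar>C\<bar> * 1 \<le> \<bar>C\<bar> * m" using m1(1) by (intro mult_left_mono) auto
    moreover have "- (\<bar>K\<bar> * m) \<le> K * m"
      using mult_right_mono[of "- \<bar>K\<bar>" K m] m1(1) by simp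
    ultimately have "0 \<le> 4 * \<alpha> * m * m + K * m + C" by (simp add: distrib_right)
    also have "4 * \<alpha> * m * m + K * m + C
        = (m + \<alpha>) * (m + \<sigma>) * (2 * m + \<sigma> + 2) - m * ((m + \<beta> + 1) * (2 * m + \<sigma>))"
      unfolding K_def C_def \<sigma>_def by algebra
    finally have "m * ((m + \<beta> + 1) * (2 * m + \<sigma>)) \<le> (m + \<alpha>) * (m + \<sigma>) * (2 * m + \<sigma> + 2)" by simp
    then have "m \<le> (m + \<alpha>) * (m + \<sigma>) * (2 * m + \<sigma> + 2) / ((m + \<beta> + 1) * (2 * m + \<sigma>))"
      using pos by (simp add: pos_le_divide_eq)
    then show ?thesis using m1(1) by simp
  qed
  define M where "M n = real n + 1 + t" for n
  have a_Suc: "a (Suc n) = a n * ((M n + \<alpha>) * (M n + \<sigma>) * (2 * M n + \<sigma> + 2)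
      / ((M n + \<beta> + 1) * (2 * M n + \<sigma>) * (M n + 1)))" for n
  proof -
    let ?k = "int n + 1"
    have "a (Suc n) = a n * ((y_seq \<alpha> \<beta> t ?k / x_seq \<alpha> \<beta> t ?k)\<^sup>2 *
        (s_seq \<alpha> \<beta> t ?k * x_seq \<alpha> \<beta> t ?k / (t_seq \<alpha> \<beta> t (?k + 1) * y_seq \<alpha> \<beta> t ?k)))"
      using wh_step[of "int n"] by (simp add: a_def add.commute mult_ac)
    also have "(y_seq \<alpha> \<beta> t ?k / x_seq \<alpha> \<beta> t ?k)\<^sup>2 *
        (s_seq \<alpha> \<beta> t ?k * x_seq \<alpha> \<beta> t ?k / (t_seq \<alpha> \<beta> t (?k + 1) * y_seq \<alpha> \<beta> t ?k))
      = (y_seq \<alpha> \<beta> t ?k / x_seq \<alpha> \<beta> t ?k) * (s_seq \<alpha> \<beta> t ?k / t_seq \<alpha> \<beta> t (?k + 1))"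
      using nz(1,2)[of ?k] by (simp add: power2_eq_square)
    also have "y_seq \<alpha> \<beta> t ?k / x_seq \<alpha> \<beta> t ?k = (M n + \<alpha>) / (M n + \<beta> + 1)"
    proof -
      have "y_seq \<alpha> \<beta> t ?k = (M n + \<alpha>) / (2 * M n + \<sigma> + 1)" "x_seq \<alpha> \<beta> t ?k = (M n + \<beta> + 1) / (2 * M n + \<sigma> + 1)"
        by (simp_all add: y_seq_def x_seq_def M_def \<sigma>_def algebra_simps)
      moreover have "2 * M n + \<sigma> + 1 \<noteq> 0"
        using denominators_nz(2)[of ?k] by (simp add: M_def \<sigma>_def algebra_simps)
      ultimately show ?thesis by simp
    qed
    also have "s_seq \<alpha> \<beta> t ?k / t_seq \<alpha> \<beta> t (?k + 1)
        = (M n + \<sigma>) / (2 * M n + \<sigma>) / ((M n + 1) / (2 * M n + \<sigma> + 2))"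
      by (simp add: s_seq_def t_seq_def M_def \<sigma>_def algebra_simps)
    finally show ?thesis by (simp add: mult_ac)
  qed
  obtain N where N: "B \<le> M N"
  proof -
    obtain N :: nat where "B - 1 - t \<le> real N" using real_arch_simple by blast
    then show ?thesis using that[of N] by (simp add: M_def)
  qed
  have M_ge: "B \<le> M n" if "N \<le> n" for n using N that by (simp add: M_def)
  have B1: "1 \<le> B" by (simp add: B_def)
  have lower: "a N * M N \<le> a n * M n" if "N \<le> n" for n
    using that
  proof (induction n rule: dec_induct)
    case (step n)
    have "a n * M n \<le> a n * ((M n + 1) * ((M n + \<alpha>) * (M n + \<sigma>) * (2 * M n + \<sigma> + 2)
      / ((M n + \<beta> + 1) * (2 * M n + \<sigma>) * (M n + 1))))"
      using ratio[OF M_ge[OF step(1)]] a_pos[of n] by (intro mult_left_mono) auto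
    also have "\<dots> = a (Suc n) * (M n + 1)" unfolding a_Suc by (simp only: mult_ac)
    also have "M n + 1 = M (Suc n)" by (simp add: M_def)
    finally show ?case using step by simp
  qed simp
  define c' where "c' = a N * M N / (1 + \<bar>t\<bar>)"
  have MN: "0 < M N" using N B1 by linarith
  have c': "0 < c'" using a_pos[of N] MN by (simp add: c'_def add_pos_nonneg)
  have "norm (c' * inverse (real (Suc n))) \<le> a n" if n: "N \<le> n" for n
  proof -
    have Mn: "0 < M n" using M_ge[OF n] B1 by linarith
    have "M n \<le> (1 + \<bar>t\<bar>) * real (Suc n)"
    proof -
      have "t \<le> \<bar>t\<bar> * real (Suc n)" using mult_left_mono[of 1 "real (Suc n)" "\<bar>t\<bar>"] by simp
      then show ?thesis by (simp add: M_def algebra_simps)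
    qed
    then have "a N * M N \<le> a n * ((1 + \<bar>t\<bar>) * real (Suc n))"
      using lower[OF n] a_pos[of n] mult_left_mono[of "M n" _ "a n"] by (meson less_imp_le order_trans)
    then have "c' \<le> a n * real (Suc n)"
      unfolding c'_def by (subst pos_divide_le_eq) (simp_all add: mult_ac add_pos_nonneg)
    then have "c' * inverse (real (Suc n)) \<le> a n"
      by (simp add: field_simps)
    then show ?thesis using c' by (simp add: abs_mult)
  qed
  then have "summable (\<lambda>n. c' * inverse (real (Suc n)))"
    by (intro summable_comparison_test[OF _ summ]) blast
  then have "summable (\<lambda>n. inverse (real (Suc n)))"
    using c' summable_mult_D[of c'] by simp
  then show False using not_summable_harmonic[where 'a = real] by (subst (asm) summable_Suc_iff) simp
qed

lemma spectral_matrix_Phat: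
  fixes \<Psi> :: "real set \<Rightarrow> real^2^2" and \<psi> :: "real \<Rightarrow> real^2^2"
  assumes \<Psi>: "spectral_matrix (P_mat \<alpha> \<beta> t) \<Psi>" and \<psi>: "has_density_on \<Psi> {0..1} \<psi>"
  defines "W \<equiv> (\<lambda>x. (x_seq \<alpha> \<beta> t 0 / t_seq \<alpha> \<beta> t 1) *\<^sub>R
                        (T0_mat \<alpha> \<beta> t x ** ((1 / x) *\<^sub>R \<psi> x) ** transpose (T0_mat \<alpha> \<beta> t x)))"
  shows "set_integrable lborel {0..1} W"
    and "spectral_matrix (Phat_mat \<alpha> \<beta> t) (\<lambda>A. LINT x:A \<inter> {0..1}|lborel. W x)"
proof -
  define V where "V z = indicator {0..1} z *\<^sub>R \<psi> z" for z :: real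
  have V_int: "integrable lborel V"
    using \<psi> by (simp add: has_density_on_def set_integrable_def V_def[abs_def])
  have \<Psi>_V: "\<Psi> A = (LINT z:A|lborel. V z)" if "A \<in> sets borel" for A
    using \<psi> that by (simp add: has_density_on_def set_lebesgue_integral_def V_def indicator_inter_arith)
  obtain Q where MM: "matrix_measure \<Psi>" and Q: "spectral_polys LU Q"
    and orth: "\<And>i j. (\<Sum>\<eta>\<in>UNIV. \<Sum>\<xi>\<in>UNIV. entry_integral \<Psi> \<eta> \<xi> (\<lambda>x. poly (Q \<eta> i) x * poly (Q \<xi> j) x))
              = (if i = j then 1 / potential LU j else 0)"
    using \<Psi> by (auto simp: spectral_matrix_def P_mat_eq_LU)
  have Q0: "Q 1 0 = 1" "Q 1 (-1) = 0" "Q 2 0 = 0" "Q 2 (-1) = 1"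
    using Q by (simp_all add: spectral_polys_def)
  have V_psd: "AE z in lborel. psd (V z)"
    by (rule density_psd_AE[OF V_int]) (use MM in \<open>simp add: matrix_measure_def \<Psi>_V[symmetric]\<close>)
  have V_supp: "V z = 0" if "z \<notin> {0..1}" for z using that by (simp add: V_def)
  define q :: "int \<Rightarrow> real \<Rightarrow> real^2" where "q n z = (\<chi> \<eta>. poly (Q \<eta> n) z)" for n z
  interpret darboux "x_seq \<alpha> \<beta> t" "y_seq \<alpha> \<beta> t" "s_seq \<alpha> \<beta> t" "t_seq \<alpha> \<beta> t" V q
  proof unfold_locales
    show "continuous_on UNIV (q n)" for n unfolding q_def by (intro continuous_intros)
    show "z *\<^sub>R q n z = LU n (n + 1) *\<^sub>R q (n + 1) z + LU n n *\<^sub>R q n z + LU n (n - 1) *\<^sub>R q (n - 1) z" for n z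
      using spectral_polys_poly[OF Q, of z _ n] by (simp add: q_def vec_eq_iff del: LU_simps)
    show "(LINT z|lborel. q i z \<bullet> (V z *v q j z)) = (if i = j then 1 / w j else 0)" for i j
    proof -
      have int: "integrable lborel (\<lambda>z. (poly (Q \<eta> i) z * poly (Q \<xi> j) z) * V z $ k $ l)" for \<eta> \<xi> k l
        by (rule integrable_cont_mult[OF integrable_bounded_linear[OF bounded_linear_entry V_int]])
          (auto simp: V_supp intro!: continuous_intros)
      have "entry_integral \<Psi> \<eta> \<xi> (\<lambda>z. poly (Q \<eta> i) z * poly (Q \<xi> j) z)
         = (LINT z|lborel. (poly (Q \<eta> i) z * poly (Q \<xi> j) z) * V z $ \<eta> $ \<xi>)" for \<eta> \<xi>
        by (rule entry_integral_density[OF \<Psi>_V V_int V_psd _ int])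
          (auto intro!: borel_measurable_continuous_onI continuous_intros)
      then have "(if i = j then 1 / w j else 0)
        = (LINT z|lborel. (\<Sum>\<eta>\<in>UNIV. \<Sum>\<xi>\<in>UNIV. (poly (Q \<eta> i) z * poly (Q \<xi> j) z) * V z $ \<eta> $ \<xi>))"
        using int orth[of i j] by (simp add: w_def)
      also have "\<dots> = (LINT z|lborel. q i z \<bullet> (V z *v q j z))"
        by (simp add: mat2_quadform q_def mult_ac)
      finally show ?thesis ..
    qed
  qed (fact V_int V_psd V_supp kernel_diverges)+
  have init: "q 0 z = axis 1 1" "q (-1) z = axis 2 1" for z
    by (simp_all add: q_def vec_eq_iff forall_2 Q0 axis_def)
  have T0: "T0_mat \<alpha> \<beta> t z $ \<eta> = T_row \<eta> z" for z \<eta>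
  proof -
    have "qh (-1) z = t_seq \<alpha> \<beta> t 0 *\<^sub>R axis 2 1 + s_seq \<alpha> \<beta> t 0 *\<^sub>R axis 1 1"
      by (simp add: qh_def init)
    moreover from this have "x_seq \<alpha> \<beta> t 0 *\<^sub>R qh 0 z = z *\<^sub>R axis 1 1
        - y_seq \<alpha> \<beta> t 0 *\<^sub>R (t_seq \<alpha> \<beta> t 0 *\<^sub>R axis 2 1 + s_seq \<alpha> \<beta> t 0 *\<^sub>R axis 1 1)"
      using qh_lower[of z 0] by (simp add: init algebra_simps)
    then have "qh 0 z = (1 / x_seq \<alpha> \<beta> t 0) *\<^sub>R (z *\<^sub>R axis 1 1
        - y_seq \<alpha> \<beta> t 0 *\<^sub>R (t_seq \<alpha> \<beta> t 0 *\<^sub>R axis 2 1 + s_seq \<alpha> \<beta> t 0 *\<^sub>R axis 1 1))"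
      by (metis divide_self nz(1) scaleR_one scaleR_scaleR times_divide_eq_left mult_1)
    ultimately show ?thesis
      using exhaust_2[of \<eta>]
      by (auto simp: T0_mat_def Let_def T_row_def vec_eq_iff forall_2 vector_2 axis_def algebra_simps diff_divide_distrib)
  qed
  have ind_W: "indicator {0..1} z *\<^sub>R W z = Vh z" for z
  proof (cases "z \<in> {0..1}")
    case True
    then have "V z = \<psi> z" by (simp add: V_def)
    then have "(\<lambda>\<eta> \<xi>. W z $ \<eta> $ \<xi>) = (\<lambda>\<eta> \<xi>. Vh z $ \<eta> $ \<xi>)"
      by (simp add: fun_eq_iff W_def Vh_def matrix_matrix_mult_def transpose_def mat2_quadform T0 sum_2 c_def
          algebra_simps add_divide_distrib)
    then show ?thesis using True by (simp add: vec_eq_iff fun_eq_iff)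
  qed (simp add: Vh_supp)
  show "set_integrable lborel {0..1} W"
    unfolding set_integrable_def ind_W by (rule Vh_int)
  have "(\<lambda>A. LINT x:A \<inter> {0..1}|lborel. W x) = (\<lambda>A. LINT z:A|lborel. Vh z)"
    by (simp add: set_lebesgue_integral_def ind_W[symmetric] indicator_inter_arith)
  then show "spectral_matrix (Phat_mat \<alpha> \<beta> t) (\<lambda>A. LINT x:A \<inter> {0..1}|lborel. W x)"
    using spectral_matrix_UL[OF init] by (simp add: Phat_mat_eq_UL)
qed

lemma Phat_mat_properties:
  "stochastic (Phat_mat \<alpha> \<beta> t)" "tridiagonal (Phat_mat \<alpha> \<beta> t)"
  "Phat_mat \<alpha> \<beta> t n (n + 1) = p_coeff (\<alpha> - 1) \<beta> t (n + 1)"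
  "Phat_mat \<alpha> \<beta> t n n = r_coeff (\<alpha> - 1) \<beta> t (n + 1)"
  "Phat_mat \<alpha> \<beta> t n (n - 1) = q_coeff (\<alpha> - 1) \<beta> t (n + 1)"
  unfolding Phat_mat_eq_UL
  by (simp_all only: UL_stochastic UL_coefficients) (auto simp: tridiagonal_def UL_def)

lemma Phat_mat_off_diagonal: "Phat_mat \<alpha> \<beta> t n (n + 1) \<noteq> 0" "Phat_mat \<alpha> \<beta> t n (n - 1) \<noteq> 0"
  unfolding Phat_mat_eq_UL by simp_all

end

theorem mainTheorem5:
  fixes \<alpha> \<beta> t :: real
  assumes "admissible \<alpha> \<beta> t"
  shows "(stochastic (Phat_mat \<alpha> \<beta> t) \<and> tridiagonal (Phat_mat \<alpha> \<beta> t) \<and>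
          (\<forall>n::int.
             Phat_mat \<alpha> \<beta> t n (n + 1) = p_coeff (\<alpha> - 1) \<beta> t (n + 1) \<and>
             Phat_mat \<alpha> \<beta> t n n = r_coeff (\<alpha> - 1) \<beta> t (n + 1) \<and>
             Phat_mat \<alpha> \<beta> t n (n - 1) = q_coeff (\<alpha> - 1) \<beta> t (n + 1)))
       \<and> (\<forall>(\<Psi> :: real set \<Rightarrow> real^2^2) (\<psi> :: real \<Rightarrow> real^2^2).
            spectral_matrix (P_mat \<alpha> \<beta> t) \<Psi> \<longrightarrow> has_density_on \<Psi> {0..1} \<psi> \<longrightarrow>
            (\<exists>\<Psi>h. spectral_matrix (Phat_mat \<alpha> \<beta> t) \<Psi>h) \<and>
            (\<forall>\<Psi>h. spectral_matrix (Phat_mat \<alpha> \<beta> t) \<Psi>h \<longrightarrow>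
               has_density_on \<Psi>h {0..1}
                 (\<lambda>x. (x_seq \<alpha> \<beta> t 0 / t_seq \<alpha> \<beta> t 1) *\<^sub>R
                        (T0_mat \<alpha> \<beta> t x ** ((1 / x) *\<^sub>R \<psi> x) ** transpose (T0_mat \<alpha> \<beta> t x)))))"
proof (intro conjI allI impI)
  show "stochastic (Phat_mat \<alpha> \<beta> t)" "tridiagonal (Phat_mat \<alpha> \<beta> t)"
    by (rule Phat_mat_properties[OF assms])+
  show "Phat_mat \<alpha> \<beta> t n (n + 1) = p_coeff (\<alpha> - 1) \<beta> t (n + 1)"
    "Phat_mat \<alpha> \<beta> t n n = r_coeff (\<alpha> - 1) \<beta> t (n + 1)"
    "Phat_mat \<alpha> \<beta> t n (n - 1) = q_coeff (\<alpha> - 1) \<beta> t (n + 1)" for n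
    by (rule Phat_mat_properties[OF assms])+
next
  fix \<Psi> :: "real set \<Rightarrow> real^2^2" and \<psi> :: "real \<Rightarrow> real^2^2"
  assume \<Psi>: "spectral_matrix (P_mat \<alpha> \<beta> t) \<Psi>" and \<psi>: "has_density_on \<Psi> {0..1} \<psi>"
  note Phat = spectral_matrix_Phat[OF assms \<Psi> \<psi>]
  show "\<exists>\<Psi>h. spectral_matrix (Phat_mat \<alpha> \<beta> t) \<Psi>h" using Phat(2) by blast
  fix \<Psi>h assume \<Psi>h: "spectral_matrix (Phat_mat \<alpha> \<beta> t) \<Psi>h"
  show "has_density_on \<Psi>h {0..1}
                 (\<lambda>x. (x_seq \<alpha> \<beta> t 0 / t_seq \<alpha> \<beta> t 1) *\<^sub>R
                        (T0_mat \<alpha> \<beta> t x ** ((1 / x) *\<^sub>R \<psi> x) ** transpose (T0_mat \<alpha> \<beta> t x)))"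
    unfolding has_density_on_def
    using Phat(1) spectral_matrix_unique[OF Phat_mat_off_diagonal[OF assms] \<Psi>h Phat(2)] by blast
qed

end
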